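(* Let $g$ be a negative-definite metric (i.e., $-g$ is a Riemannian metric) on a closed connected manifold $M$ of dimension $n$. Then every function $\lambda$ on $M$ that satisfies $$\nabla_k \nabla_j \nabla_i \lambda + 2\, \nabla_k \lambda \cdot g_{ij} + \nabla_i \lambda \cdot g_{jk} + \nabla_j \lambda \cdot g_{ik}=0 \qquad (i,j,k\in\{1,\dots,n\})$$ is constant.
   Context: All objects are smooth. $\nabla$ denotes the Levi-Civita covariant derivative of $g$ and indices refer to local coordinates on $M$. A closed manifold is a compact manifold without boundary. *)

theory Defs
  imports "HOL-Analysis.Analysis"
begin

section \<open>Smooth maps between open subsets of Euclidean spaces\<close>

fun Ck_on :: "nat \<Rightarrow> ('a::euclidean_space \<Rightarrow> 'b::real_normed_vector) \<Rightarrow> 'a set \<Rightarrow> bool" where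
  "Ck_on 0 f S \<longleftrightarrow> continuous_on S f"
| "Ck_on (Suc k) f S \<longleftrightarrow> (\<forall>x\<in>S. f differentiable (at x)) \<and>
     (\<forall>v. Ck_on k (\<lambda>x. frechet_derivative f (at x) v) S)"

text \<open>Only meaningful for open \<open>S\<close>, since derivatives are taken along the full filter \<open>at x\<close>.\<close>

definition smooth_on :: "('a::euclidean_space \<Rightarrow> 'b::real_normed_vector) \<Rightarrow> 'a set \<Rightarrow> bool" where
  "smooth_on f S \<longleftrightarrow> (\<forall>k. Ck_on k f S)"

definition partial_deriv :: "'n::finite \<Rightarrow> (real^'n \<Rightarrow> real) \<Rightarrow> real^'n \<Rightarrow> real" where
  "partial_deriv i f x = frechet_derivative f (at x) (axis i 1)"

section \<open>Smooth manifolds\<close>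

text \<open>A chart is a pair of a domain and a coordinate map; values of the latter outside the
  domain are irrelevant.\<close>

type_synonym ('m, 'n) chart = "'m set \<times> ('m \<Rightarrow> real^'n)"

definition chart_image :: "('m, 'n::finite) chart \<Rightarrow> (real^'n) set" where
  "chart_image c = snd c ` fst c"

definition chart_inv :: "('m, 'n::finite) chart \<Rightarrow> real^'n \<Rightarrow> 'm" where
  "chart_inv c = inv_into (fst c) (snd c)"

definition chart_on :: "'m topology \<Rightarrow> ('m, 'n::finite) chart \<Rightarrow> bool" where
  "chart_on X c \<longleftrightarrow> openin X (fst c) \<and> open (chart_image c) \<and>
     homeomorphic_map (subtopology X (fst c)) (top_of_set (chart_image c)) (snd c)"

definition transition :: "('m, 'n::finite) chart \<Rightarrow> ('m, 'n) chart \<Rightarrow> real^'n \<Rightarrow> real^'n" where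
  "transition c d = snd d \<circ> chart_inv c"

definition smooth_manifold :: "'m topology \<Rightarrow> ('m, 'n::finite) chart set \<Rightarrow> bool" where
  "smooth_manifold X A \<longleftrightarrow>
     Hausdorff_space X \<and> second_countable X \<and>
     (\<forall>c\<in>A. chart_on X c) \<and> (\<Union>c\<in>A. fst c) = topspace X \<and>
     (\<forall>c\<in>A. \<forall>d\<in>A. smooth_on (transition c d) (snd c ` (fst c \<inter> fst d)))"

definition smooth_function :: "('m, 'n::finite) chart set \<Rightarrow> ('m \<Rightarrow> real) \<Rightarrow> bool" where
  "smooth_function A f \<longleftrightarrow> (\<forall>c\<in>A. smooth_on (f \<circ> chart_inv c) (chart_image c))"

section \<open>Metrics\<close>

text \<open>A covariant 2-tensor field is given by its component matrices: \<open>g c x $ i $ j\<close> is the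
  component \<open>g\<^sub>i\<^sub>j\<close> with respect to the chart \<open>c\<close> at the point with coordinates \<open>x\<close>.\<close>

type_synonym ('m, 'n) tensor2 = "('m, 'n) chart \<Rightarrow> real^'n \<Rightarrow> real^'n^'n"

definition smooth_tensor2 :: "('m, 'n::finite) chart set \<Rightarrow> ('m, 'n) tensor2 \<Rightarrow> bool" where
  "smooth_tensor2 A g \<longleftrightarrow>
     (\<forall>c\<in>A. \<forall>i j. smooth_on (\<lambda>x. g c x $ i $ j) (chart_image c)) \<and>
     (\<forall>c\<in>A. \<forall>d\<in>A. \<forall>x \<in> snd c ` (fst c \<inter> fst d). \<forall>i j.
        g c x $ i $ j =
          (\<Sum>a\<in>UNIV. \<Sum>b\<in>UNIV. g d (transition c d x) $ a $ b *
             partial_deriv i (\<lambda>y. transition c d y $ a) x *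
             partial_deriv j (\<lambda>y. transition c d y $ b) x))"

definition riemannian_metric :: "('m, 'n::finite) chart set \<Rightarrow> ('m, 'n) tensor2 \<Rightarrow> bool" where
  "riemannian_metric A g \<longleftrightarrow> smooth_tensor2 A g \<and>
     (\<forall>c\<in>A. \<forall>x\<in>chart_image c. transpose (g c x) = g c x \<and>
        (\<forall>v. v \<noteq> 0 \<longrightarrow> v \<bullet> (g c x *v v) > 0))"

definition negative_definite_metric ::
    "('m, 'n::finite) chart set \<Rightarrow> ('m, 'n) tensor2 \<Rightarrow> bool" where
  "negative_definite_metric A g \<longleftrightarrow> riemannian_metric A (\<lambda>c x. - g c x)"

section \<open>Covariant differentiation\<close>

text \<open>Within one chart, a covariant tensor field \<open>T\<close> of rank \<open>r\<close> is represented by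
  its components \<open>T is\<close> for index lists \<open>is\<close> of length \<open>r\<close>, and a connection by its
  coefficients \<open>\<Gamma> k i j\<close>, the first index being the upper one. The differentiation index comes
  first: \<open>cov_deriv \<Gamma> T (k # is)\<close> is the component \<open>\<nabla>\<^sub>k T\<^sub>i\<^sub>s\<close>, of rank \<open>r + 1\<close>.\<close>

fun cov_deriv :: "('n::finite \<Rightarrow> 'n \<Rightarrow> 'n \<Rightarrow> real^'n \<Rightarrow> real) \<Rightarrow>
    ('n list \<Rightarrow> real^'n \<Rightarrow> real) \<Rightarrow> 'n list \<Rightarrow> real^'n \<Rightarrow> real" where
  "cov_deriv \<Gamma> T [] x = 0"
| "cov_deriv \<Gamma> T (k # is) x = partial_deriv k (T is) x -
     (\<Sum>m<length is. \<Sum>a\<in>UNIV. \<Gamma> a k (is ! m) x * T (is[m := a]) x)"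

definition christoffel ::
    "(real^'n \<Rightarrow> real^'n^'n) \<Rightarrow> 'n::finite \<Rightarrow> 'n \<Rightarrow> 'n \<Rightarrow> real^'n \<Rightarrow> real" where
  "christoffel G k i j x = (1/2) * (\<Sum>l\<in>UNIV. matrix_inv (G x) $ k $ l *
     (partial_deriv i (\<lambda>y. G y $ j $ l) x + partial_deriv j (\<lambda>y. G y $ i $ l) x
        - partial_deriv l (\<lambda>y. G y $ i $ j) x))"

text \<open>\<open>nabla g c f [k\<^sub>1, \<dots>, k\<^sub>r]\<close> is \<open>\<nabla>\<^bsub>k\<^sub>1\<^esub> \<dots> \<nabla>\<^bsub>k\<^sub>r\<^esub> f\<close> in the chart \<open>c\<close>, for the Levi-Civita
  connection of \<open>g\<close>. The iteration starts from the rank 0 tensor field \<open>f\<close>, whose only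
  component is the one for the empty index list.\<close>

definition nabla :: "('m, 'n::finite) tensor2 \<Rightarrow> ('m, 'n) chart \<Rightarrow> ('m \<Rightarrow> real) \<Rightarrow>
    'n list \<Rightarrow> real^'n \<Rightarrow> real" where
  "nabla g c f is =
     (cov_deriv (christoffel (g c)) ^^ length is) (\<lambda>_. f \<circ> chart_inv c) is"

text \<open>The coefficients above are those of the Levi-Civita connection: they are the only
  symmetric (torsion-free) ones for which the metric is parallel.\<close>

lemma partial_deriv_cong_open:
  assumes "open S" "x \<in> S" "\<And>y. y \<in> S \<Longrightarrow> f y = h y"
  shows "partial_deriv i f x = partial_deriv i h x"
proof -
  have "(f has_derivative D) (at x) \<longleftrightarrow> (h has_derivative D) (at x)" for D
    using assms has_derivative_transform_within_open[of f D x UNIV S h]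
      has_derivative_transform_within_open[of h D x UNIV S f] by auto
  then show ?thesis
    by (simp add: partial_deriv_def frechet_derivative_def)
qed

lemma nabla_simps:
  "nabla g c f [k] x = partial_deriv k (f \<circ> chart_inv c) x"
  "nabla g c f [j, i] x = partial_deriv j (nabla g c f [i]) x -
     (\<Sum>a\<in>UNIV. christoffel (g c) a j i x * nabla g c f [a] x)"
  "nabla g c f [k, j, i] x = partial_deriv k (nabla g c f [j, i]) x -
     (\<Sum>a\<in>UNIV. christoffel (g c) a k j x * nabla g c f [a, i] x) -
     (\<Sum>a\<in>UNIV. christoffel (g c) a k i x * nabla g c f [j, a] x)"
  by (simp_all add: nabla_def numeral_eq_Suc lessThan_Suc)

lemma levi_civita_unique:
  fixes G :: "real^'n \<Rightarrow> real^'n^'n::finite"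
  assumes S: "open S" "x \<in> S"
    and sym: "\<And>y. y \<in> S \<Longrightarrow> transpose (G y) = G y" and inv: "invertible (G x)"
  shows "(\<forall>a i j. \<Gamma> a i j x = \<Gamma> a j i x) \<and>
           (\<forall>k i j. cov_deriv \<Gamma> (\<lambda>is y. G y $ (is ! 0) $ (is ! 1)) [k, i, j] x = 0)
         \<longleftrightarrow> (\<forall>a i j. \<Gamma> a i j x = christoffel G a i j x)"
proof -
  define d where "d k i j = partial_deriv k (\<lambda>y. G y $ i $ j) x" for k i j
  define H where "H = matrix_inv (G x)"
  define low where "low \<Gamma> l i j = (\<Sum>a\<in>UNIV. \<Gamma> a i j x * G x $ a $ l)"
    for \<Gamma> :: "'n \<Rightarrow> 'n \<Rightarrow> 'n \<Rightarrow> real^'n \<Rightarrow> real" and l i j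
  have Gs: "G y $ i $ j = G y $ j $ i" if "y \<in> S" for y i j
    using sym[OF that] by (metis transpose_def vec_lambda_beta)
  have ds: "d k i j = d k j i" for k i j
    unfolding d_def by (rule partial_deriv_cong_open[OF S]) (rule Gs)
  have inv2: "G x ** H = mat 1" "H ** G x = mat 1"
    using someI_ex[OF inv[unfolded invertible_def]] by (simp_all add: H_def matrix_inv_def)
  have GH: "(\<Sum>l\<in>UNIV. G x $ a $ l * H $ l $ b) = (if a = b then 1 else 0)"
    and HG: "(\<Sum>l\<in>UNIV. H $ a $ l * G x $ l $ b) = (if a = b then 1 else 0)" for a b
    using inv2 by (simp_all add: vec_eq_iff matrix_matrix_mult_def mat_def)
  have Hs: "H $ a $ b = H $ b $ a" for a b
  proof -
    have "transpose H ** G x = mat 1"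
      by (metis inv2(1) matrix_transpose_mul sym[OF S(2)] transpose_mat)
    then have "transpose H = H"
      by (metis inv2(1) matrix_mul_assoc matrix_mul_lid matrix_mul_rid)
    then show ?thesis by (metis transpose_def vec_lambda_beta)
  qed
  have nab: "cov_deriv \<Gamma> (\<lambda>is y. G y $ (is ! 0) $ (is ! 1)) [k, i, j] x
      = d k i j - low \<Gamma> j k i - low \<Gamma> i k j" for \<Gamma> k i j
    by (simp add: numeral_eq_Suc lessThan_Suc d_def low_def Gs[OF S(2), of i])
  have raise: "\<Gamma> a i j x = (\<Sum>l\<in>UNIV. H $ a $ l * low \<Gamma> l i j)" for \<Gamma> a i j
  proof -
    have "(\<Sum>l\<in>UNIV. H $ a $ l * low \<Gamma> l i j)
        = (\<Sum>l\<in>UNIV. \<Sum>b\<in>UNIV. \<Gamma> b i j x * (G x $ b $ l * H $ l $ a))"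
      by (simp add: low_def sum_distrib_left Hs[of a] ac_simps)
    also have "\<dots> = (\<Sum>b\<in>UNIV. \<Gamma> b i j x * (\<Sum>l\<in>UNIV. G x $ b $ l * H $ l $ a))"
      by (subst sum.swap) (simp add: sum_distrib_left)
    also have "\<dots> = \<Gamma> a i j x" by (simp add: GH if_distrib cong: if_cong)
    finally show ?thesis by simp
  qed
  have chr: "christoffel G a i j x
      = (\<Sum>l\<in>UNIV. H $ a $ l * ((d i j l + d j i l - d l i j) / 2))" for a i j
    by (simp add: christoffel_def H_def d_def sum_distrib_left)
  have lowchr: "low (christoffel G) l i j = (d i j l + d j i l - d l i j) / 2" for l i j
  proof -
    have "low (christoffel G) l i j
      = (\<Sum>b\<in>UNIV. \<Sum>m\<in>UNIV. (d i j m + d j i m - d m i j) / 2 * (H $ m $ b * G x $ b $ l))"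
      unfolding low_def chr sum_distrib_right
      by (intro sum.cong refl) (simp add: Hs)
    also have "\<dots> = (\<Sum>m\<in>UNIV. (d i j m + d j i m - d m i j) / 2 *
        (\<Sum>b\<in>UNIV. H $ m $ b * G x $ b $ l))"
      by (subst sum.swap) (simp add: sum_distrib_left)
    also have "\<dots> = (d i j l + d j i l - d l i j) / 2"
      by (simp add: HG if_distrib cong: if_cong)
    finally show ?thesis .
  qed
  show ?thesis
  proof (intro iffI conjI allI)
    fix a i j
    assume A: "(\<forall>a i j. \<Gamma> a i j x = \<Gamma> a j i x) \<and>
       (\<forall>k i j. cov_deriv \<Gamma> (\<lambda>is y. G y $ (is ! 0) $ (is ! 1)) [k, i, j] x = 0)"
    then have s: "low \<Gamma> l i j = low \<Gamma> l j i" for l i j by (simp add: low_def)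
    have p: "d k i j = low \<Gamma> j k i + low \<Gamma> i k j" for k i j
      using conjunct2[OF A] by (simp only: nab) (simp add: algebra_simps)
    have "low \<Gamma> l i j = (d i j l + d j i l - d l i j) / 2" for l
      by (simp only: p s[of _ l] s[of l j]) (simp add: s[of _ j i])
    then show "\<Gamma> a i j x = christoffel G a i j x"
      by (simp only: raise[of \<Gamma> a i j] chr)
  next
    fix a i j
    assume A: "\<forall>a i j. \<Gamma> a i j x = christoffel G a i j x"
    then show "\<Gamma> a i j x = \<Gamma> a j i x" by (simp add: chr ds[of _ i j] add.commute)
  next
    fix k i j
    assume "\<forall>a i j. \<Gamma> a i j x = christoffel G a i j x"
    then have "low \<Gamma> = low (christoffel G)" by (simp add: low_def fun_eq_iff)
    then show "cov_deriv \<Gamma> (\<lambda>is y. G y $ (is ! 0) $ (is ! 1)) [k, i, j] x = 0"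
      by (simp only: nab lowchr)
        (simp add: field_simps ds[of _ j i] ds[of _ j k] ds[of _ k i])
  qed
qed

end

theory Submission
  imports Defs
begin

text \<open>Write \<open>\<Delta>\<lambda> = g\<^sup>i\<^sup>j \<nabla>\<^sub>i \<nabla>\<^sub>j \<lambda>\<close>. The metric is parallel, so contracting the
  equation with \<open>g\<^sup>i\<^sup>j\<close> gives \<open>\<nabla>\<^sub>k (\<Delta>\<lambda>) + 2 n \<nabla>\<^sub>k \<lambda> + \<nabla>\<^sub>k \<lambda> + \<nabla>\<^sub>k \<lambda> = 0\<close>, that is,
  \<open>\<Delta>\<lambda> + 2 (n + 1) \<lambda>\<close> has vanishing gradient (\<open>gradient_laplacian_equation\<close>). On a connected
  manifold it is a constant \<open>C\<close>. Since \<open>g\<close> is negative definite, \<open>\<Delta>\<close> is minus the Laplacian of the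
  Riemannian metric \<open>-g\<close>, hence \<open>\<Delta>\<lambda> \<ge> 0\<close> where \<open>\<lambda>\<close> is maximal
  (\<open>laplacian_nonneg_at_max\<close>) and \<open>\<Delta>\<lambda> \<le> 0\<close> where it is minimal. Both points exist by
  compactness, and they yield \<open>2 (n + 1) max \<lambda> \<le> C \<le> 2 (n + 1) min \<lambda>\<close>, so \<open>\<lambda>\<close> is constant.

  The tensor fields are given by components in charts, so two facts that are invisible in the
  invariant notation have to be proved. First, contraction with the inverse metric commutes with
  covariant differentiation (\<open>partial_deriv_metric_trace\<close>). Second, \<open>\<Delta>\<lambda>\<close> is a well-defined
  function on the manifold, independent of the chart (\<open>laplacian_chart_independent\<close>); this is
  needed because the constants found in different charts have to be compared. For the second
  fact the Levi-Civita connection of one chart, pulled back along the transition map, is shown to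
  be symmetric and metric, and is therefore the Levi-Civita connection of the other chart.

  The index computations are organised as matrix identities: for fixed \<open>k\<close>, the Christoffel
  symbols form a matrix \<open>C\<^sub>k\<close>, the metric is parallel if and only if
  \<open>\<partial>\<^sub>k G = C\<^sub>k\<^sup>T G + G C\<^sub>k\<close>, and contraction with the inverse metric is the trace pairing
  \<open>tr (G\<^sup>-\<^sup>1 H)\<close>.\<close>

section \<open>Partial derivatives\<close>

lemma has_derivative_frechet:
  "f differentiable at x \<Longrightarrow> (f has_derivative frechet_derivative f (at x)) (at x)"
  using frechet_derivative_works by blast

lemma partial_deriv_eq:
  "(f has_derivative D) (at x) \<Longrightarrow> partial_deriv i f x = D (axis i 1)"
  unfolding partial_deriv_def using frechet_derivative_at by metis

lemma frechet_derivative_partials: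
  fixes f :: "real^'n::finite \<Rightarrow> real"
  assumes "f differentiable at x"
  shows "frechet_derivative f (at x) v = (\<Sum>i\<in>UNIV. v $ i * partial_deriv i f x)"
proof -
  have lin: "linear (frechet_derivative f (at x))"
    using assms by (rule linear_frechet_derivative)
  have "frechet_derivative f (at x) v = frechet_derivative f (at x) (\<Sum>i\<in>UNIV. v $ i *\<^sub>R axis i 1)"
    by (simp add: basis_expansion flip: scalar_mult_eq_scaleR)
  also have "\<dots> = (\<Sum>i\<in>UNIV. v $ i * partial_deriv i f x)"
    by (simp add: linear_sum[OF lin] linear_scale[OF lin] partial_deriv_def)
  finally show ?thesis .
qed

lemma partial_deriv_add:
  assumes "f differentiable at x" "h differentiable at x"
  shows "partial_deriv i (\<lambda>y. f y + h y) x = partial_deriv i f x + partial_deriv i h x"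
  using partial_deriv_eq[OF has_derivative_add[OF assms[THEN has_derivative_frechet]]]
  by (simp add: partial_deriv_def)

lemma partial_deriv_uminus:
  assumes "f differentiable at x"
  shows "partial_deriv i (\<lambda>y. - f y) x = - partial_deriv i f x"
  using partial_deriv_eq[OF has_derivative_minus[OF assms[THEN has_derivative_frechet]]]
  by (simp add: partial_deriv_def)

lemma partial_deriv_mult:
  assumes "f differentiable at x" "h differentiable at x"
  shows "partial_deriv i (\<lambda>y. f y * h y) x
    = f x * partial_deriv i h x + partial_deriv i f x * h x"
  using partial_deriv_eq[OF has_derivative_mult[OF assms[THEN has_derivative_frechet]]]
  by (simp add: partial_deriv_def)

lemma partial_deriv_const [simp]: "partial_deriv i (\<lambda>y. c) x = 0"
  by (simp add: partial_deriv_def)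

lemma partial_deriv_sum:
  assumes "\<And>a. a \<in> I \<Longrightarrow> f a differentiable at x"
  shows "partial_deriv i (\<lambda>y. \<Sum>a\<in>I. f a y) x = (\<Sum>a\<in>I. partial_deriv i (f a) x)"
proof -
  have "((\<lambda>y. \<Sum>a\<in>I. f a y) has_derivative
     (\<lambda>v. \<Sum>a\<in>I. frechet_derivative (f a) (at x) v)) (at x)"
    by (intro has_derivative_sum has_derivative_frechet assms)
  from partial_deriv_eq[OF this] show ?thesis
    by (simp add: partial_deriv_def)
qed

lemma partial_deriv_component:
  fixes f :: "real^'m::finite \<Rightarrow> real^'n::finite"
  assumes "f differentiable at x"
  shows "partial_deriv i (\<lambda>y. f y $ a) x = frechet_derivative f (at x) (axis i 1) $ a"
  using bounded_linear.has_derivative[OF bounded_linear_vec_nth has_derivative_frechet[OF assms]]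
  by (rule partial_deriv_eq)

lemma partial_deriv_compose:
  fixes \<tau> :: "real^'n::finite \<Rightarrow> real^'m::finite"
  assumes f: "f differentiable at (\<tau> x)" and \<tau>: "\<tau> differentiable at x"
  shows "partial_deriv i (\<lambda>y. f (\<tau> y)) x
    = (\<Sum>a\<in>UNIV. partial_deriv i (\<lambda>y. \<tau> y $ a) x * partial_deriv a f (\<tau> x))"
proof -
  have "partial_deriv i (\<lambda>y. f (\<tau> y)) x
      = frechet_derivative f (at (\<tau> x)) (frechet_derivative \<tau> (at x) (axis i 1))"
    using frechet_derivative_compose[OF \<tau> f] by (simp add: partial_deriv_def o_def)
  then show ?thesis
    by (simp add: frechet_derivative_partials[OF f] partial_deriv_component[OF \<tau>])
qed

text \<open>A ball is enough: the constants obtained on different balls are patched together later, on the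
  connected manifold.\<close>

lemma constant_near_zero_partials:
  fixes f :: "real^'n::finite \<Rightarrow> real"
  assumes "\<And>y. y \<in> ball x r \<Longrightarrow> f differentiable at y"
    and "\<And>y i. y \<in> ball x r \<Longrightarrow> partial_deriv i f y = 0"
    and "y \<in> ball x r"
  shows "f y = f x"
proof -
  have "(f has_derivative (\<lambda>h. 0)) (at z)" if "z \<in> ball x r" for z
  proof -
    have "frechet_derivative f (at z) = (\<lambda>h. 0)"
      using that by (simp add: fun_eq_iff frechet_derivative_partials assms)
    then show ?thesis using has_derivative_frechet[OF assms(1)[OF that]] by simp
  qed
  then have "(f has_derivative (\<lambda>h. 0)) (at z within ball x r)" if "z \<in> ball x r" for z
    using that has_derivative_at_withinI by blast
  moreover have "x \<in> ball x r" using assms(3) by (metis ball_empty centre_in_ball empty_iff not_le)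
  ultimately show ?thesis
    using has_derivative_zero_unique[OF convex_ball, of x r f y x] assms(3) by simp
qed

lemma DERIV_along_line:
  fixes f :: "'a::real_normed_vector \<Rightarrow> real"
  assumes "f differentiable at (p + t *\<^sub>R v)"
  shows "((\<lambda>t. f (p + t *\<^sub>R v)) has_real_derivative
           frechet_derivative f (at (p + t *\<^sub>R v)) v) (at t)"
proof -
  have "((\<lambda>t. p + t *\<^sub>R v) has_derivative (\<lambda>h. h *\<^sub>R v)) (at t)"
    by (auto intro!: derivative_eq_intros)
  from diff_chain_at[OF this has_derivative_frechet[OF assms]]
  have "((\<lambda>t. f (p + t *\<^sub>R v)) has_derivative
      (\<lambda>h. frechet_derivative f (at (p + t *\<^sub>R v)) (h *\<^sub>R v))) (at t)"
    by (simp add: o_def)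
  then show ?thesis
    using linear_scale[OF linear_frechet_derivative[OF assms]]
    by (simp add: has_field_derivative_def mult_commute_abs)
qed

section \<open>Smooth functions\<close>

text \<open>The derivatives are taken along the full filter at a point, so openness of the set is what makes
  them depend only on the values in it.\<close>

lemma Ck_on_cong:
  assumes "open S" "\<And>x. x \<in> S \<Longrightarrow> f x = h x" "Ck_on k f S"
  shows "Ck_on k h S"
  using assms(2,3)
proof (induction k arbitrary: f h)
  case 0
  then show ?case by (simp cong: continuous_on_cong)
next
  case (Suc k)
  have D: "f differentiable at x" if "x \<in> S" for x using Suc.prems that by simp
  have "h differentiable at x" if "x \<in> S" for x
    using has_derivative_transform_within_open[OF has_derivative_frechet[OF D[OF that]] \<open>open S\<close> that]
      Suc.prems(1) unfolding differentiable_def by blast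
  moreover have "Ck_on k (\<lambda>x. frechet_derivative h (at x) v) S" for v
  proof (rule Suc.IH)
    show "Ck_on k (\<lambda>x. frechet_derivative f (at x) v) S" using Suc.prems(2) by simp
    show "frechet_derivative f (at x) v = frechet_derivative h (at x) v" if "x \<in> S" for x
      using frechet_derivative_transform_within_open[OF D \<open>open S\<close> that Suc.prems(1)] that by metis
  qed
  ultimately show ?case by simp
qed

text \<open>Covers both the passage to components of a vector-valued map and the change of sign.\<close>

lemma Ck_on_bounded_linear:
  assumes h: "bounded_linear h" and "open S" "Ck_on k f S"
  shows "Ck_on k (\<lambda>x. h (f x)) S"
  using assms(3)
proof (induction k arbitrary: f)
  case 0
  then show ?case using bounded_linear.continuous_on[OF h] by simp
next
  case (Suc k)
  have D: "((\<lambda>x. h (f x)) has_derivative (\<lambda>v. h (frechet_derivative f (at x) v))) (at x)"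
    if "x \<in> S" for x
    using bounded_linear.has_derivative[OF h has_derivative_frechet] Suc.prems that by auto
  then have eq: "h (frechet_derivative f (at x) v) = frechet_derivative (\<lambda>x. h (f x)) (at x) v"
    if "x \<in> S" for x v
    using frechet_derivative_at[OF D[OF that]] by metis
  have "Ck_on k (\<lambda>x. frechet_derivative (\<lambda>x. h (f x)) (at x) v) S" for v
  proof (rule Ck_on_cong[OF \<open>open S\<close>])
    show "Ck_on k (\<lambda>x. h (frechet_derivative f (at x) v)) S" using Suc by auto
  qed (rule eq)
  then show ?case
    by (auto intro: differentiableI[OF D])
qed

lemma smooth_on_component:
  fixes f :: "'a::euclidean_space \<Rightarrow> real^'n::finite"
  shows "open S \<Longrightarrow> smooth_on f S \<Longrightarrow> smooth_on (\<lambda>x. f x $ a) S"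
  by (simp add: smooth_on_def Ck_on_bounded_linear[OF bounded_linear_vec_nth])

lemma smooth_on_uminus: "open S \<Longrightarrow> smooth_on f S \<Longrightarrow> smooth_on (\<lambda>x. - f x) S"
  by (simp add: smooth_on_def Ck_on_bounded_linear[OF bounded_linear_minus[OF bounded_linear_ident]])

lemma smooth_on_subset: "smooth_on f S \<Longrightarrow> T \<subseteq> S \<Longrightarrow> smooth_on f T"
proof -
  have "Ck_on k f S \<Longrightarrow> T \<subseteq> S \<Longrightarrow> Ck_on k f T" for k
    by (induction k arbitrary: f) (auto intro: continuous_on_subset)
  then show "smooth_on f S \<Longrightarrow> T \<subseteq> S \<Longrightarrow> smooth_on f T"
    by (simp add: smooth_on_def)
qed

lemma smooth_on_imp_differentiable:
  "smooth_on f S \<Longrightarrow> x \<in> S \<Longrightarrow> f differentiable at x"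
  unfolding smooth_on_def by (metis Ck_on.simps(2))

lemma smooth_on_imp_continuous_on: "smooth_on f S \<Longrightarrow> continuous_on S f"
  unfolding smooth_on_def by (metis Ck_on.simps(1))

lemma smooth_on_partial_deriv: "smooth_on f S \<Longrightarrow> smooth_on (partial_deriv i f) S"
  unfolding smooth_on_def partial_deriv_def[abs_def] by (metis Ck_on.simps(2))

text \<open>The mean value theorem, applied once in each of the two directions. The left-hand side is symmetric
  in \<open>i\<close> and \<open>j\<close>, which gives Schwarz's theorem on mixed derivatives.\<close>

lemma second_difference:
  fixes f :: "real^'n::finite \<Rightarrow> real"
  assumes f: "smooth_on f S" and h: "0 < h" and S: "cball x (2 * h) \<subseteq> S"
  obtains y where "y \<in> cball x (2 * h)"
    "f (x + h *\<^sub>R axis i 1 + h *\<^sub>R axis j 1) - f (x + h *\<^sub>R axis i 1) - f (x + h *\<^sub>R axis j 1) + f x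
       = h * h * partial_deriv j (partial_deriv i f) y"
proof -
  let ?e = "\<lambda>i::'n. axis i (1::real)"
  have in_ball: "x + s *\<^sub>R ?e i + t *\<^sub>R ?e j \<in> cball x (2 * h)"
    if "0 \<le> s" "s \<le> h" "0 \<le> t" "t \<le> h" for s t
  proof -
    have "norm (s *\<^sub>R ?e i + t *\<^sub>R ?e j) \<le> norm (s *\<^sub>R ?e i) + norm (t *\<^sub>R ?e j)"
      by (rule norm_triangle_ineq)
    also have "\<dots> \<le> 2 * h" using that by (simp add: norm_axis_1)
    finally show ?thesis
      using norm_minus_cancel[of "s *\<^sub>R ?e i + t *\<^sub>R ?e j"] by (simp add: dist_norm algebra_simps)
  qed
  have d: "f differentiable at (x + s *\<^sub>R ?e i + t *\<^sub>R ?e j)"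
    "partial_deriv i f differentiable at (x + s *\<^sub>R ?e i + t *\<^sub>R ?e j)"
    if "0 \<le> s" "s \<le> h" "0 \<le> t" "t \<le> h" for s t
    using in_ball[OF that] S smooth_on_imp_differentiable[OF f]
      smooth_on_imp_differentiable[OF smooth_on_partial_deriv[OF f]] by blast+
  have 1: "((\<lambda>s. f (x + s *\<^sub>R ?e i + t *\<^sub>R ?e j)) has_real_derivative
      partial_deriv i f (x + s *\<^sub>R ?e i + t *\<^sub>R ?e j)) (at s)"
    if "0 \<le> s" "s \<le> h" "0 \<le> t" "t \<le> h" for s t
    using DERIV_along_line[of f "x + t *\<^sub>R ?e j" s "?e i"] d(1)[OF that]
    by (simp add: partial_deriv_def ac_simps)
  have 2: "((\<lambda>t. partial_deriv i f (x + s *\<^sub>R ?e i + t *\<^sub>R ?e j)) has_real_derivative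
      partial_deriv j (partial_deriv i f) (x + s *\<^sub>R ?e i + t *\<^sub>R ?e j)) (at t)"
    if "0 \<le> s" "s \<le> h" "0 \<le> t" "t \<le> h" for s t
    using DERIV_along_line[OF d(2)[OF that]]
    by (simp add: partial_deriv_def[of j])
  have "\<exists>s>0. s < h \<and>
    f (x + h *\<^sub>R ?e i + h *\<^sub>R ?e j) - f (x + h *\<^sub>R ?e i + 0 *\<^sub>R ?e j)
      - (f (x + 0 *\<^sub>R ?e i + h *\<^sub>R ?e j) - f (x + 0 *\<^sub>R ?e i + 0 *\<^sub>R ?e j))
     = (h - 0) * (partial_deriv i f (x + s *\<^sub>R ?e i + h *\<^sub>R ?e j)
                 - partial_deriv i f (x + s *\<^sub>R ?e i + 0 *\<^sub>R ?e j))"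
    by (rule MVT2[OF h, of "\<lambda>s. f (x + s *\<^sub>R ?e i + h *\<^sub>R ?e j) - f (x + s *\<^sub>R ?e i + 0 *\<^sub>R ?e j)"])
      (intro DERIV_diff 1; use h in simp)
  then obtain s where s: "0 < s" "s < h" and
    A: "f (x + h *\<^sub>R ?e i + h *\<^sub>R ?e j) - f (x + h *\<^sub>R ?e i + 0 *\<^sub>R ?e j)
      - (f (x + 0 *\<^sub>R ?e i + h *\<^sub>R ?e j) - f (x + 0 *\<^sub>R ?e i + 0 *\<^sub>R ?e j))
     = (h - 0) * (partial_deriv i f (x + s *\<^sub>R ?e i + h *\<^sub>R ?e j)
                 - partial_deriv i f (x + s *\<^sub>R ?e i + 0 *\<^sub>R ?e j))"
    by blast
  have "\<exists>t>0. t < h \<and>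
    partial_deriv i f (x + s *\<^sub>R ?e i + h *\<^sub>R ?e j) - partial_deriv i f (x + s *\<^sub>R ?e i + 0 *\<^sub>R ?e j)
     = (h - 0) * partial_deriv j (partial_deriv i f) (x + s *\<^sub>R ?e i + t *\<^sub>R ?e j)"
    by (rule MVT2[OF h, of "\<lambda>t. partial_deriv i f (x + s *\<^sub>R ?e i + t *\<^sub>R ?e j)"])
      (intro 2; use s in simp)
  then obtain t where t: "0 < t" "t < h" and
    B: "partial_deriv i f (x + s *\<^sub>R ?e i + h *\<^sub>R ?e j) - partial_deriv i f (x + s *\<^sub>R ?e i + 0 *\<^sub>R ?e j)
     = (h - 0) * partial_deriv j (partial_deriv i f) (x + s *\<^sub>R ?e i + t *\<^sub>R ?e j)"
    by blast
  show ?thesis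
    using that[OF in_ball, of s t] s t A[unfolded B] by (simp add: algebra_simps)
qed

text \<open>Schwarz's theorem. If the two mixed derivatives at \<open>x\<close> differed, then by continuity so would
  their values at any two points close to \<open>x\<close>; but the second difference for a small step is a value of both.\<close>

lemma partial_deriv_commute:
  fixes f :: "real^'n::finite \<Rightarrow> real"
  assumes f: "smooth_on f S" and S: "open S" "x \<in> S"
  shows "partial_deriv i (partial_deriv j f) x = partial_deriv j (partial_deriv i f) x"
proof (rule ccontr)
  let ?P = "\<lambda>i j. partial_deriv j (partial_deriv i f)"
  assume ne: "\<not> ?thesis"
  define e where "e = \<bar>?P i j x - ?P j i x\<bar> / 2"
  have e: "e > 0" using ne by (simp add: e_def)
  have "\<exists>d>0. \<forall>y\<in>S. dist y x < d \<longrightarrow> dist (?P i j y) (?P i j x) < e" for i j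
    using smooth_on_imp_continuous_on[OF smooth_on_partial_deriv[OF smooth_on_partial_deriv[OF f]]]
      S(2) e unfolding continuous_on_iff by blast
  then obtain d1 d2 where d: "d1 > 0" "d2 > 0"
    "\<And>y. y \<in> S \<Longrightarrow> dist y x < d1 \<Longrightarrow> dist (?P i j y) (?P i j x) < e"
    "\<And>y. y \<in> S \<Longrightarrow> dist y x < d2 \<Longrightarrow> dist (?P j i y) (?P j i x) < e" by metis
  obtain r where r: "r > 0" "cball x r \<subseteq> S" using S open_contains_cball by blast
  define h where "h = Min {r, d1, d2} / 4"
  have h: "h > 0" "2 * h < d1" "2 * h < d2" "2 * h \<le> r" using r d by (auto simp: h_def min_def)
  then have sub: "cball x (2 * h) \<subseteq> S" using r by (meson order_trans subset_cball)
  obtain y where y: "y \<in> cball x (2 * h)" and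
    yd: "f (x + h *\<^sub>R axis i 1 + h *\<^sub>R axis j 1) - f (x + h *\<^sub>R axis i 1) - f (x + h *\<^sub>R axis j 1) + f x
       = h * h * ?P i j y" by (rule second_difference[OF f h(1) sub])
  obtain z where z: "z \<in> cball x (2 * h)" and
    zd: "f (x + h *\<^sub>R axis j 1 + h *\<^sub>R axis i 1) - f (x + h *\<^sub>R axis j 1) - f (x + h *\<^sub>R axis i 1) + f x
       = h * h * ?P j i z" by (rule second_difference[OF f h(1) sub])
  have "h * h * ?P i j y = h * h * ?P j i z"
    unfolding yd[symmetric] zd[symmetric] by (simp add: ac_simps)
  then have "?P i j y = ?P j i z" using h by simp
  moreover have "dist (?P i j y) (?P i j x) < e" "dist (?P j i z) (?P j i x) < e"
    using y z h sub d(3)[of y] d(4)[of z] by (auto simp: dist_commute)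
  ultimately show False
    unfolding e_def dist_real_def by argo
qed

text \<open>The restriction of the function to a line through the maximum has nonpositive second
  derivative: otherwise its first derivative, zero at the maximum, would be positive just after.\<close>

lemma second_derivative_nonpos_at_max:
  fixes f :: "real^'n::finite \<Rightarrow> real"
  assumes f: "smooth_on f S" and S: "open S" "x \<in> S" and max: "\<And>y. y \<in> S \<Longrightarrow> f y \<le> f x"
  shows "partial_deriv i f x = 0"
    and "(\<Sum>i\<in>UNIV. \<Sum>j\<in>UNIV. v $ i * v $ j * partial_deriv j (partial_deriv i f) x) \<le> 0"
proof -
  have fd: "f differentiable at y" "partial_deriv i f differentiable at y" if "y \<in> S" for y i
    using that smooth_on_imp_differentiable[OF f]
      smooth_on_imp_differentiable[OF smooth_on_partial_deriv[OF f]] by auto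
  have crit: "partial_deriv i f x = 0" for i
    using differential_zero_maxmin[OF S(2,1) has_derivative_frechet[OF fd(1)[OF S(2)]]] max
    by (simp add: partial_deriv_def)
  then show "partial_deriv i f x = 0" .
  obtain r where r: "r > 0" "ball x r \<subseteq> S" using S open_contains_ball by blast
  define \<delta> where "\<delta> = r / (norm v + 1)"
  have \<delta>: "\<delta> > 0" using r by (simp add: \<delta>_def add_nonneg_pos)
  have inS: "x + t *\<^sub>R v \<in> S" if "0 \<le> t" "t < \<delta>" for t
  proof -
    have "t * norm v \<le> t * (norm v + 1)" using that by (simp add: mult_left_mono)
    also have "\<dots> < r" using that by (simp add: \<delta>_def pos_less_divide_eq add_nonneg_pos)
    finally show ?thesis using r that by (auto simp: dist_norm)
  qed
  define \<phi> where "\<phi> t = f (x + t *\<^sub>R v)" for t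
  define \<phi>' where "\<phi>' t = (\<Sum>i\<in>UNIV. v $ i * partial_deriv i f (x + t *\<^sub>R v))" for t
  let ?q = "\<Sum>i\<in>UNIV. \<Sum>j\<in>UNIV. v $ i * v $ j * partial_deriv j (partial_deriv i f) x"
  have d1: "(\<phi> has_real_derivative \<phi>' t) (at t)" if "0 \<le> t" "t < \<delta>" for t
    using DERIV_along_line[OF fd(1)[OF inS[OF that]]] fd(1)[OF inS[OF that]]
    by (simp add: \<phi>_def[abs_def] \<phi>'_def frechet_derivative_partials)
  have "((\<lambda>t. partial_deriv i f (x + t *\<^sub>R v)) has_real_derivative
      (\<Sum>j\<in>UNIV. v $ j * partial_deriv j (partial_deriv i f) x)) (at 0)" for i
    using DERIV_along_line[of "partial_deriv i f" x 0 v] fd(2)[OF S(2)]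
    by (simp add: frechet_derivative_partials)
  then have d2: "(\<phi>' has_real_derivative ?q) (at 0)"
    unfolding \<phi>'_def[abs_def]
    by (auto intro!: derivative_eq_intros sum.cong simp: sum_distrib_left ac_simps)
  show "?q \<le> 0"
  proof (rule ccontr)
    assume "\<not> ?q \<le> 0"
    then obtain d where d: "d > 0" "\<And>h. 0 < h \<Longrightarrow> h < d \<Longrightarrow> \<phi>' 0 < \<phi>' h"
      using DERIV_pos_inc_right[OF d2] by auto
    define t where "t = min d \<delta> / 2"
    have t: "0 < t" "t < d" "t < \<delta>" using d \<delta> by (auto simp: t_def)
    obtain z where z: "0 < z" "z < t" "\<phi> t - \<phi> 0 = (t - 0) * \<phi>' z"
      using MVT2[OF t(1), of \<phi> \<phi>'] d1 t by force
    have "\<phi>' z > 0" using d(2)[of z] z t crit by (simp add: \<phi>'_def)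
    then have "\<phi> t > \<phi> 0" using z t by (smt (verit) mult_pos_pos)
    then show False using max[OF inS[of t]] t by (simp add: \<phi>_def)
  qed
qed

section \<open>Positive semidefinite matrices\<close>

lemma inner_matrix_vector:
  fixes M :: "real^'n^'n::finite"
  shows "v \<bullet> (M *v v) = (\<Sum>i\<in>UNIV. \<Sum>j\<in>UNIV. v $ i * v $ j * M $ i $ j)"
  by (simp add: inner_vec_def matrix_vector_mult_def sum_distrib_left ac_simps)

text \<open>The Cauchy-Schwarz inequality for the semidefinite form of \<open>P\<close>, between \<open>v\<close> and a basis
  vector: minimise the form along the line through \<open>v\<close> in the direction of that basis vector. The
  degenerate case \<open>P $ s $ s = 0\<close> says that the whole row vanishes.\<close>

lemma psd_Cauchy_Schwarz:
  fixes P :: "real^'n^'n::finite"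
  assumes sym: "transpose P = P" and psd: "\<And>v. 0 \<le> v \<bullet> (P *v v)"
  shows "(P $ s \<bullet> v)\<^sup>2 \<le> P $ s $ s * (v \<bullet> (P *v v))"
proof -
  let ?e = "axis s (1::real)" and ?q = "v \<bullet> (P *v v)" and ?b = "P $ s \<bullet> v"
  have Pe: "?e \<bullet> (P *v v) = ?b"
    by (simp add: inner_axis' matrix_vector_mul_component)
  have eP: "v \<bullet> (P *v ?e) = ?b"
    using Pe sym by (metis dot_lmul_matrix vector_transpose_matrix inner_commute)
  have ePe: "?e \<bullet> (P *v ?e) = P $ s $ s"
    by (simp add: inner_axis' inner_axis matrix_vector_mul_component)
  have expand: "0 \<le> ?q + 2 * t * ?b + t * t * P $ s $ s" for t
    using psd[of "v + t *\<^sub>R ?e"]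
    by (simp add: matrix_vector_right_distrib matrix_vector_mult_scaleR inner_simps Pe eP ePe
        algebra_simps)
  show ?thesis
  proof (cases "P $ s $ s = 0")
    case True
    have "?b = 0"
    proof (rule ccontr)
      assume "?b \<noteq> 0"
      then show False using expand[of "- (?q + 1) / (2 * ?b)"] True by (simp add: field_simps)
    qed
    then show ?thesis using True by simp
  next
    case False
    moreover have "0 \<le> P $ s $ s" using psd[of ?e] by (simp add: ePe)
    ultimately have pos: "P $ s $ s > 0" by simp
    have "0 \<le> ?q - ?b * ?b / P $ s $ s"
      using expand[of "- ?b / P $ s $ s"] pos by (simp add: field_simps)
    then show ?thesis using pos by (simp add: field_simps power2_eq_square)
  qed
qed

text \<open>The easy half of the Fejer theorem: the entrywise pairing of semidefinite forms is nonnegative.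
  A semidefinite \<open>P\<close> is reduced to zero by Schur complements: subtracting the rank-one matrix
  built from the row \<open>s\<close> clears this row, keeps semidefiniteness by the Cauchy-Schwarz inequality,
  and changes the pairing by a nonnegative multiple of a value of the form of \<open>N\<close>.\<close>

lemma psd_pairing_nonneg:
  fixes P N :: "real^'n^'n::finite"
  assumes "transpose P = P" and "\<And>v. 0 \<le> v \<bullet> (P *v v)" and N: "\<And>v. 0 \<le> v \<bullet> (N *v v)"
  shows "0 \<le> (\<Sum>i\<in>UNIV. \<Sum>j\<in>UNIV. P $ i $ j * N $ i $ j)"
proof -
  have "0 \<le> (\<Sum>i\<in>UNIV. \<Sum>j\<in>UNIV. P $ i $ j * N $ i $ j)"
    if "finite S" "transpose P = P" "\<And>v. 0 \<le> v \<bullet> (P *v v)" "\<And>i j. i \<notin> S \<Longrightarrow> P $ i $ j = 0"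
    for S and P :: "real^'n^'n"
    using that
  proof (induction S arbitrary: P rule: finite_induct)
    case empty
    then show ?case by simp
  next
    case (insert s S)
    note CS = psd_Cauchy_Schwarz[OF insert.prems(1,2), of s]
    have sym: "P $ i $ j = P $ j $ i" for i j
      using arg_cong[OF insert.prems(1), of "\<lambda>M. M $ j $ i"] by (simp add: transpose_def)
    have Pss: "0 \<le> P $ s $ s"
      using insert.prems(2)[of "axis s 1"]
      by (simp add: inner_axis' inner_axis matrix_vector_mul_component)
    \<comment> \<open>If \<open>P $ s $ s = 0\<close>, then \<open>R = 0\<close> because division by zero gives zero; the row \<open>s\<close>
      of \<open>P\<close> vanishes already.\<close>
    define R where "R = (\<chi> i j. P $ s $ i * P $ s $ j / P $ s $ s)"
    have R: "v \<bullet> (R *v v) = (P $ s \<bullet> v)\<^sup>2 / P $ s $ s" for v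
      unfolding inner_matrix_vector
      unfolding power2_eq_square inner_vec_def sum_product sum_divide_distrib
      by (intro sum.cong refl) (simp add: R_def)
    have RN: "(\<Sum>i\<in>UNIV. \<Sum>j\<in>UNIV. R $ i $ j * N $ i $ j) = P $ s \<bullet> (N *v P $ s) / P $ s $ s"
      unfolding inner_matrix_vector
      unfolding sum_divide_distrib
      by (intro sum.cong refl) (simp add: R_def)
    have "0 \<le> (\<Sum>i\<in>UNIV. \<Sum>j\<in>UNIV. (P - R) $ i $ j * N $ i $ j)"
    proof (rule insert.IH)
      show "transpose (P - R) = P - R"
        by (simp add: vec_eq_iff transpose_def R_def sym ac_simps)
      show "0 \<le> v \<bullet> ((P - R) *v v)" for v
      proof (cases "P $ s $ s = 0")
        case True
        then show ?thesis
          using insert.prems(2)[of v] by (simp add: matrix_vector_mult_diff_rdistrib inner_diff_right R)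
      next
        case False
        then have "(P $ s \<bullet> v)\<^sup>2 / P $ s $ s \<le> v \<bullet> (P *v v)"
          using CS[of v] Pss by (simp add: field_simps)
        then show ?thesis by (simp add: matrix_vector_mult_diff_rdistrib inner_diff_right R)
      qed
      show "(P - R) $ i $ j = 0" if "i \<notin> S" for i j
      proof (cases "i = s")
        case True
        have "P $ s $ j = 0" if "P $ s $ s = 0"
          using CS[of "axis j 1"] that by (simp add: inner_axis)
        then show ?thesis using True by (auto simp: R_def)
      next
        case False
        then show ?thesis
          using insert.prems(3)[of i] that by (auto simp: R_def sym[of s i])
      qed
    qed
    moreover have "0 \<le> P $ s \<bullet> (N *v P $ s) / P $ s $ s" using N Pss by simp
    ultimately show ?case
      by (simp add: RN[symmetric] algebra_simps sum_subtractf)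
  qed
  from this[of UNIV P] assms show ?thesis by simp
qed

section \<open>Matrix algebra\<close>

lemma matrix_mult_uminus_left:
  fixes M :: "'a::ring_1^'n::finite^'m"
  shows "(- M) ** N = - (M ** N)"
  by (simp add: vec_eq_iff matrix_matrix_mult_def sum_negf)

lemma matrix_mult_add_left:
  fixes M :: "'a::semiring_1^'n::finite^'m"
  shows "(M + N) ** P = M ** P + N ** P"
  by (simp add: vec_eq_iff matrix_matrix_mult_def sum.distrib distrib_right)

lemma matrix_mult_diff_right:
  fixes M :: "'a::ring_1^'n::finite^'m"
  shows "M ** (N - P) = M ** N - M ** P"
  by (simp add: vec_eq_iff matrix_matrix_mult_def sum_subtractf right_diff_distrib)

lemma transpose_add: "transpose (M + N) = transpose M + transpose N"
  by (simp add: vec_eq_iff transpose_def)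

lemma trace_uminus: "trace (- M :: 'a::comm_ring_1^'n::finite^'n) = - trace M"
  by (simp add: trace_def sum_negf)

lemma invertible_matrix_inv:
  assumes "invertible G"
  shows "G ** matrix_inv G = mat 1" "matrix_inv G ** G = mat 1"
  using someI_ex[OF assms[unfolded invertible_def]] by (simp_all add: matrix_inv_def)

lemma matrix_inv_unique:
  fixes G :: "real^'n^'n::finite"
  assumes "B ** G = mat 1"
  shows "invertible G" "matrix_inv G = B"
proof -
  show "invertible G" using assms by (simp add: invertible_left_inverse) blast
  from invertible_matrix_inv(1)[OF this] show "matrix_inv G = B"
    by (metis assms matrix_mul_assoc matrix_mul_lid matrix_mul_rid)
qed

lemma transpose_matrix_inv:
  fixes G :: "real^'n^'n::finite"
  assumes "invertible G"
  shows "transpose (matrix_inv G) = matrix_inv (transpose G)"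
  using invertible_matrix_inv(1)[OF assms]
  by (metis matrix_inv_unique(2) matrix_transpose_mul transpose_mat)

lemma definite_imp_invertible:
  fixes G :: "real^'n^'n::finite"
  assumes "\<And>v. v \<noteq> 0 \<Longrightarrow> v \<bullet> (G *v v) \<noteq> 0"
  shows "invertible G"
proof -
  have "G *v v = 0 \<Longrightarrow> v = 0" for v using assms[of v] by auto
  then show ?thesis
    by (simp add: invertible_left_inverse matrix_left_invertible_ker)
qed

lemma matrix_inv_negative_definite:
  fixes G :: "real^'n^'n::finite"
  assumes "\<And>v. v \<noteq> 0 \<Longrightarrow> v \<bullet> (G *v v) < 0"
  shows "v \<bullet> (matrix_inv G *v v) \<le> 0"
proof -
  have inv: "invertible G" using assms by (intro definite_imp_invertible) (metis less_irrefl)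
  define w where "w = matrix_inv G *v v"
  have "v = G *v w"
    by (simp add: w_def matrix_vector_mul_assoc invertible_matrix_inv[OF inv])
  then have "v \<bullet> (matrix_inv G *v v) = w \<bullet> (G *v w)"
    by (metis w_def inner_commute)
  also have "\<dots> \<le> 0" using assms[of w] by (cases "w = 0") auto
  finally show ?thesis .
qed

text \<open>Applied with a Jacobian as \<open>J\<close>, which is invertible because the pulled-back metric is.\<close>

lemma invertible_congruenceD:
  fixes G J :: "real^'n^'n::finite"
  assumes "invertible (transpose J ** G ** J)"
  shows "invertible J"
  using invertible_matrix_inv(2)[OF assms] by (auto simp: invertible_left_inverse matrix_mul_assoc)

text \<open>The trace pairing \<open>tr (G\<^sup>-\<^sup>1 H)\<close> of two bilinear forms is invariant under a change of basis:
  \<open>G\<^sup>-\<^sup>1 = J (J\<^sup>T G J)\<^sup>-\<^sup>1 J\<^sup>T\<close>, and the trace is cyclic.\<close>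

lemma trace_matrix_inv_congruence:
  fixes G H J :: "real^'n^'n::finite"
  assumes inv: "invertible (transpose J ** G ** J)"
  shows "trace (matrix_inv (transpose J ** G ** J) ** (transpose J ** H ** J))
       = trace (matrix_inv G ** H)"
proof -
  let ?B = "matrix_inv (transpose J ** G ** J)"
  have "?B ** transpose J ** G ** J = mat 1"
    using invertible_matrix_inv(2)[OF inv] by (simp add: matrix_mul_assoc)
  then have "J ** (?B ** transpose J ** G) = mat 1"
    by (simp add: matrix_left_right_inverse)
  then have "J ** ?B ** transpose J ** G = mat 1" by (simp add: matrix_mul_assoc)
  then have B: "matrix_inv G = J ** ?B ** transpose J" by (rule matrix_inv_unique)
  have "trace (?B ** (transpose J ** H ** J)) = trace ((?B ** transpose J ** H) ** J)"
    by (simp add: matrix_mul_assoc)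
  also have "\<dots> = trace (J ** (?B ** transpose J ** H))" by (rule trace_mul_sym)
  finally show ?thesis by (simp add: B matrix_mul_assoc)
qed

lemma differentiable_prod:
  fixes f :: "'i \<Rightarrow> 'a::real_normed_vector \<Rightarrow> real"
  assumes "\<And>i. i \<in> I \<Longrightarrow> f i differentiable at x"
  shows "(\<lambda>y. \<Prod>i\<in>I. f i y) differentiable at x"
  using assms by (induction I rule: infinite_finite_induct) (auto intro: differentiable_mult)

lemma differentiable_cong_open:
  assumes "f differentiable at x" "open S" "x \<in> S" "\<And>y. y \<in> S \<Longrightarrow> f y = h y"
  shows "h differentiable at x"
  using assms has_derivative_transform_within_open unfolding differentiable_def by blast

lemma differentiable_det:
  fixes M :: "'a::real_normed_vector \<Rightarrow> real^'n^'n::finite"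
  assumes "\<And>i j. (\<lambda>y. M y $ i $ j) differentiable at x"
  shows "(\<lambda>y. det (M y)) differentiable at x"
  unfolding det_def
  by (intro differentiable_sum ballI finite differentiable_mult differentiable_prod differentiable_const assms)

text \<open>By Cramer's rule the entries of the inverse are quotients of determinants.\<close>

lemma differentiable_matrix_inv:
  fixes G :: "'a::real_normed_vector \<Rightarrow> real^'n^'n::finite"
  assumes S: "open S" "x \<in> S" and inv: "\<And>y. y \<in> S \<Longrightarrow> invertible (G y)"
    and d: "\<And>i j. (\<lambda>y. G y $ i $ j) differentiable at x"
  shows "(\<lambda>y. matrix_inv (G y) $ i $ j) differentiable at x"
proof -
  let ?M = "\<lambda>y. \<chi> a b. if b = i then axis j 1 $ a else G y $ a $ b"
  have eq: "det (?M y) / det (G y) = matrix_inv (G y) $ i $ j" if "y \<in> S" for y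
  proof -
    have "G y *v (matrix_inv (G y) *v axis j 1) = axis j 1"
      by (simp add: matrix_vector_mul_assoc invertible_matrix_inv inv that)
    then have "matrix_inv (G y) *v axis j 1 = (\<chi> k. det (\<chi> a b. if b = k then axis j 1 $ a else G y $ a $ b) / det (G y))"
      using inv[OF that] by (intro iffD1[OF cramer]) (simp_all add: invertible_det_nz)
    then have "(matrix_inv (G y) *v axis j 1) $ i = det (?M y) / det (G y)" by simp
    then show ?thesis
      by (simp add: matrix_vector_mul_component inner_axis)
  qed
  have "(\<lambda>y. det (?M y)) differentiable at x"
  proof (rule differentiable_det)
    show "(\<lambda>y. ?M y $ a $ b) differentiable at x" for a b
      by (cases "b = i") (simp_all add: d)
  qed
  moreover have "(\<lambda>y. det (G y)) differentiable at x"
    by (rule differentiable_det) (rule d)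
  moreover have "det (G x) \<noteq> 0"
    using inv[OF S(2)] by (simp add: invertible_det_nz)
  ultimately have "(\<lambda>y. det (?M y) / det (G y)) differentiable at x"
    by (intro differentiable_divide)
  from differentiable_cong_open[OF this S eq] show ?thesis .
qed

section \<open>Derivatives of matrix-valued functions\<close>

text \<open>Differentiability is required entry by entry because partial derivatives are defined for
  real-valued functions only.\<close>

definition entries_differentiable ::
    "(real^'n::finite \<Rightarrow> real^'a::finite^'b::finite) \<Rightarrow> real^'n \<Rightarrow> bool" where
  "entries_differentiable M x \<longleftrightarrow> (\<forall>i j. (\<lambda>y. M y $ i $ j) differentiable at x)"

definition matrix_partial ::
    "'n::finite \<Rightarrow> (real^'n \<Rightarrow> real^'a::finite^'b::finite) \<Rightarrow> real^'n \<Rightarrow> real^'a^'b" where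
  "matrix_partial k M x = (\<chi> i j. partial_deriv k (\<lambda>y. M y $ i $ j) x)"

lemma entries_differentiable_mult:
  assumes "entries_differentiable M x" "entries_differentiable N x"
  shows "entries_differentiable (\<lambda>y. M y ** N y) x"
  using assms unfolding entries_differentiable_def matrix_matrix_mult_def
  by (auto intro!: differentiable_sum differentiable_mult)

lemma matrix_partial_mult:
  assumes "entries_differentiable M x" "entries_differentiable N x"
  shows "matrix_partial k (\<lambda>y. M y ** N y) x = matrix_partial k M x ** N x + M x ** matrix_partial k N x"
  using assms unfolding entries_differentiable_def matrix_partial_def matrix_matrix_mult_def
  by (simp add: vec_eq_iff partial_deriv_sum partial_deriv_mult sum.distrib ac_simps)

lemma entries_differentiable_transpose:
  "entries_differentiable M x \<Longrightarrow> entries_differentiable (\<lambda>y. transpose (M y)) x"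
  unfolding entries_differentiable_def transpose_def by simp

lemma matrix_partial_transpose:
  "matrix_partial k (\<lambda>y. transpose (M y)) x = transpose (matrix_partial k M x)"
  by (simp add: matrix_partial_def transpose_def)

lemma matrix_partial_cong_open:
  "open S \<Longrightarrow> x \<in> S \<Longrightarrow> (\<And>y. y \<in> S \<Longrightarrow> M y = N y) \<Longrightarrow> matrix_partial k M x = matrix_partial k N x"
  unfolding matrix_partial_def vec_eq_iff by (auto intro!: partial_deriv_cong_open)

lemma matrix_partial_const: "matrix_partial k (\<lambda>y. M) x = 0"
  by (simp add: matrix_partial_def vec_eq_iff)

lemma partial_deriv_trace:
  assumes "entries_differentiable M x"
  shows "partial_deriv k (\<lambda>y. trace (M y)) x = trace (matrix_partial k M x)"
  using assms by (simp add: trace_def matrix_partial_def entries_differentiable_def partial_deriv_sum)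

text \<open>The product rule applied to \<open>G\<^sup>-\<^sup>1 G = 1\<close>; differentiability of the inverse comes from Cramer's rule.\<close>

lemma matrix_partial_inverse:
  fixes G :: "real^'n::finite \<Rightarrow> real^'a^'a::finite"
  assumes S: "open S" "x \<in> S" and inv: "\<And>y. y \<in> S \<Longrightarrow> invertible (G y)"
    and d: "entries_differentiable G x"
  shows "entries_differentiable (\<lambda>y. matrix_inv (G y)) x"
    and "matrix_partial k (\<lambda>y. matrix_inv (G y)) x
           = - (matrix_inv (G x) ** matrix_partial k G x ** matrix_inv (G x))"
proof -
  let ?B = "\<lambda>y. matrix_inv (G y)"
  show dB: "entries_differentiable ?B x"
    unfolding entries_differentiable_def
    using differentiable_matrix_inv[of S x G, OF S inv] d[unfolded entries_differentiable_def] by blast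
  have "matrix_partial k (\<lambda>y. ?B y ** G y) x = 0"
    using matrix_partial_cong_open[OF S, of "\<lambda>y. ?B y ** G y" "\<lambda>y. mat 1"] inv
    by (simp add: invertible_matrix_inv matrix_partial_const)
  then have "matrix_partial k ?B x ** G x = - (?B x ** matrix_partial k G x)"
    by (simp add: matrix_partial_mult[OF dB d] eq_neg_iff_add_eq_0)
  then have "matrix_partial k ?B x ** G x ** ?B x = - (?B x ** matrix_partial k G x) ** ?B x"
    by simp
  then show "matrix_partial k ?B x = - (?B x ** matrix_partial k G x ** ?B x)"
    using invertible_matrix_inv(1)[OF inv[OF S(2)]]
    by (simp add: matrix_mult_uminus_left flip: matrix_mul_assoc)
qed

section \<open>The Levi-Civita connection\<close>

text \<open>With \<open>k\<close> fixed this is the endomorphism \<open>\<nabla>\<^sub>k - \<partial>\<^sub>k\<close> of the tangent space.\<close>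

definition christoffel_matrix ::
    "(real^'n \<Rightarrow> real^'n^'n) \<Rightarrow> 'n::finite \<Rightarrow> real^'n \<Rightarrow> real^'n^'n" where
  "christoffel_matrix G k x = (\<chi> a j. christoffel G a k j x)"

lemma parallel_metric_iff:
  fixes G :: "real^'n::finite \<Rightarrow> real^'n^'n"
  assumes sym: "transpose (G x) = G x"
  shows "(\<forall>k i j. cov_deriv \<Gamma> (\<lambda>is y. G y $ (is ! 0) $ (is ! 1)) [k, i, j] x = 0)
    \<longleftrightarrow> (\<forall>k. matrix_partial k G x
          = transpose (\<chi> a j. \<Gamma> a k j x) ** G x + G x ** (\<chi> a j. \<Gamma> a k j x))"
proof -
  have "cov_deriv \<Gamma> (\<lambda>is y. G y $ (is ! 0) $ (is ! 1)) [k, i, j] x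
      = (matrix_partial k G x -
         (transpose (\<chi> a j. \<Gamma> a k j x) ** G x + G x ** (\<chi> a j. \<Gamma> a k j x))) $ i $ j" for k i j
    by (simp add: numeral_eq_Suc lessThan_Suc matrix_partial_def matrix_matrix_mult_def
        transpose_def mult.commute)
  then show ?thesis
    by (auto simp: vec_eq_iff)
qed

lemma christoffel_parallel:
  fixes G :: "real^'n::finite \<Rightarrow> real^'n^'n"
  assumes S: "open S" "x \<in> S"
    and sym: "\<And>y. y \<in> S \<Longrightarrow> transpose (G y) = G y" and inv: "invertible (G x)"
  shows "christoffel G a i j x = christoffel G a j i x"
    and "matrix_partial k G x
      = transpose (christoffel_matrix G k x) ** G x + G x ** christoffel_matrix G k x"
proof -
  have "(\<forall>a i j. christoffel G a i j x = christoffel G a j i x) \<and>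
      (\<forall>k. matrix_partial k G x
        = transpose (\<chi> a j. christoffel G a k j x) ** G x + G x ** (\<chi> a j. christoffel G a k j x))"
    using levi_civita_unique[of S x G, OF S sym inv, of "christoffel G"] sym[OF S(2)]
    by (simp only: parallel_metric_iff) blast
  then show "christoffel G a i j x = christoffel G a j i x"
    and "matrix_partial k G x
      = transpose (christoffel_matrix G k x) ** G x + G x ** christoffel_matrix G k x"
    unfolding christoffel_matrix_def by blast+
qed

lemma christoffel_matrix_unique:
  fixes G :: "real^'n::finite \<Rightarrow> real^'n^'n"
  assumes S: "open S" "x \<in> S"
    and sym: "\<And>y. y \<in> S \<Longrightarrow> transpose (G y) = G y" and inv: "invertible (G x)"
    and "\<And>a i j. D i $ a $ j = D j $ a $ i"
    and "\<And>k. matrix_partial k G x = transpose (D k) ** G x + G x ** D k"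
  shows "D k = christoffel_matrix G k x"
proof -
  have D: "(\<chi> a j. D k $ a $ j) = D k" for k by (simp add: vec_eq_iff)
  have "\<forall>a i j. D i $ a $ j = christoffel G a i j x"
    using levi_civita_unique[of S x G, OF S sym inv, of "\<lambda>a i j y. D i $ a $ j"] sym[OF S(2)] assms(5,6)
    by (simp only: parallel_metric_iff D) blast
  then show ?thesis
    by (simp add: christoffel_matrix_def vec_eq_iff)
qed

text \<open>Contraction commutes with covariant differentiation. Parallelism gives
  \<open>\<partial>\<^sub>k G\<^sup>-\<^sup>1 = - G\<^sup>-\<^sup>1 C\<^sub>k\<^sup>T - C\<^sub>k G\<^sup>-\<^sup>1\<close>, and by cyclicity of the trace these two terms are the
  Christoffel terms of \<open>\<nabla>\<^sub>k H\<close>.\<close>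

lemma partial_deriv_metric_trace:
  fixes G H :: "real^'n::finite \<Rightarrow> real^'n^'n"
  assumes S: "open S" "x \<in> S"
    and sym: "\<And>y. y \<in> S \<Longrightarrow> transpose (G y) = G y" and inv: "\<And>y. y \<in> S \<Longrightarrow> invertible (G y)"
    and d: "entries_differentiable G x" "entries_differentiable H x"
  defines "C \<equiv> christoffel_matrix G"
  shows "partial_deriv k (\<lambda>y. trace (matrix_inv (G y) ** H y)) x
    = trace (matrix_inv (G x) ** (matrix_partial k H x - transpose (C k x) ** H x - H x ** C k x))"
proof -
  let ?B = "matrix_inv (G x)" and ?C = "C k x"
  note dB = matrix_partial_inverse[OF S inv d(1)]
  have par: "matrix_partial k G x = transpose ?C ** G x + G x ** ?C"
    unfolding C_def by (rule christoffel_parallel(2)[of S x G, OF S sym inv[OF S(2)]])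
  have B: "?B ** G x = mat 1" "G x ** ?B = mat 1" using invertible_matrix_inv[OF inv[OF S(2)]] by auto
  have "?B ** matrix_partial k G x ** ?B = ?B ** transpose ?C ** (G x ** ?B) + (?B ** G x) ** ?C ** ?B"
    by (simp add: par matrix_add_ldistrib matrix_mult_add_left matrix_mul_assoc)
  then have dB2: "matrix_partial k (\<lambda>y. matrix_inv (G y)) x = - (?B ** transpose ?C + ?C ** ?B)"
    by (simp add: dB(2) B)
  have "partial_deriv k (\<lambda>y. trace (matrix_inv (G y) ** H y)) x
     = trace (- (?B ** transpose ?C + ?C ** ?B) ** H x + ?B ** matrix_partial k H x)"
    by (simp add: partial_deriv_trace entries_differentiable_mult dB d matrix_partial_mult dB2)
  also have "\<dots> = trace (?B ** matrix_partial k H x) - trace (?B ** transpose ?C ** H x) - trace (?C ** (?B ** H x))"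
    by (simp only: trace_add trace_uminus matrix_mult_add_left matrix_mult_uminus_left matrix_mul_assoc)
  also have "trace (?C ** (?B ** H x)) = trace (?B ** H x ** ?C)"
    by (rule trace_mul_sym)
  finally show ?thesis
    by (simp add: matrix_mult_diff_right trace_sub matrix_mul_assoc)
qed

section \<open>Hessian and Laplacian in one chart\<close>

text \<open>Invertibility takes the place of definiteness: the Levi-Civita calculus is the same in every
  signature.\<close>

definition smooth_metric_on :: "(real^'n::finite \<Rightarrow> real^'n^'n) \<Rightarrow> (real^'n) set \<Rightarrow> bool" where
  "smooth_metric_on G S \<longleftrightarrow> open S \<and> (\<forall>x\<in>S. transpose (G x) = G x \<and> invertible (G x)) \<and>
     (\<forall>i j. smooth_on (\<lambda>x. G x $ i $ j) S)"

definition hessian :: "(real^'n::finite \<Rightarrow> real^'n^'n) \<Rightarrow> (real^'n \<Rightarrow> real) \<Rightarrow> real^'n \<Rightarrow> real^'n^'n" where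
  "hessian G f x = (\<chi> i j. partial_deriv i (partial_deriv j f) x -
     (\<Sum>a\<in>UNIV. christoffel G a i j x * partial_deriv a f x))"

definition laplacian :: "(real^'n::finite \<Rightarrow> real^'n^'n) \<Rightarrow> (real^'n \<Rightarrow> real) \<Rightarrow> real^'n \<Rightarrow> real" where
  "laplacian G f x = trace (matrix_inv (G x) ** hessian G f x)"

lemma smooth_metric_onD:
  assumes "smooth_metric_on G S"
  shows "open S" "x \<in> S \<Longrightarrow> transpose (G x) = G x" "x \<in> S \<Longrightarrow> invertible (G x)"
    "smooth_on (\<lambda>x. G x $ i $ j) S" "x \<in> S \<Longrightarrow> entries_differentiable G x"
  using assms unfolding smooth_metric_on_def entries_differentiable_def
  by (auto intro: smooth_on_imp_differentiable)

lemma smooth_metric_on_subset: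
  "smooth_metric_on G S \<Longrightarrow> T \<subseteq> S \<Longrightarrow> open T \<Longrightarrow> smooth_metric_on G T"
  unfolding smooth_metric_on_def by (auto intro: smooth_on_subset[of _ S T])

lemma entries_differentiable_metric_inverse:
  assumes G: "smooth_metric_on G S" and x: "x \<in> S"
  shows "entries_differentiable (\<lambda>y. matrix_inv (G y)) x"
  using matrix_partial_inverse(1)[of S x G] smooth_metric_onD[OF G] x by blast

lemma differentiable_christoffel:
  assumes G: "smooth_metric_on G S" and x: "x \<in> S"
  shows "christoffel G a i j differentiable at x"
proof -
  have "(\<lambda>y. matrix_inv (G y) $ a $ l) differentiable at x" for l
    using entries_differentiable_metric_inverse[OF G x] by (simp add: entries_differentiable_def)
  moreover have "(\<lambda>y. partial_deriv i (\<lambda>y. G y $ j $ l) y) differentiable at x" for i j l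
    using smooth_on_imp_differentiable[OF smooth_on_partial_deriv[OF smooth_metric_onD(4)[OF G]] x] .
  ultimately show ?thesis
    unfolding christoffel_def[abs_def]
    by (intro differentiable_mult differentiable_sum ballI finite differentiable_diff differentiable_add
        differentiable_const)
qed

lemma entries_differentiable_hessian:
  assumes G: "smooth_metric_on G S" and f: "smooth_on f S" and x: "x \<in> S"
  shows "entries_differentiable (hessian G f) x"
proof -
  have "partial_deriv a f differentiable at x" "partial_deriv i (partial_deriv a f) differentiable at x" for i a
    using smooth_on_imp_differentiable[OF _ x] smooth_on_partial_deriv f by metis+
  then have "(\<lambda>y. partial_deriv i (partial_deriv j f) y -
     (\<Sum>a\<in>UNIV. christoffel G a i j y * partial_deriv a f y)) differentiable at x" for i j
    by (intro differentiable_diff differentiable_sum ballI finite differentiable_mult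
        differentiable_christoffel[OF G x])
  then show ?thesis
    by (simp add: entries_differentiable_def hessian_def)
qed

lemma differentiable_laplacian:
  assumes G: "smooth_metric_on G S" and f: "smooth_on f S" and x: "x \<in> S"
  shows "laplacian G f differentiable at x"
  using entries_differentiable_mult[OF entries_differentiable_metric_inverse[OF G x]
      entries_differentiable_hessian[OF G f x]]
  unfolding laplacian_def[abs_def] trace_def entries_differentiable_def
  by (auto intro!: differentiable_sum)

lemma partial_deriv_laplacian:
  assumes G: "smooth_metric_on G S" and f: "smooth_on f S" and x: "x \<in> S"
  defines "C \<equiv> christoffel_matrix G"
  shows "partial_deriv k (laplacian G f) x
    = trace (matrix_inv (G x) ** (matrix_partial k (hessian G f) x
        - transpose (C k x) ** hessian G f x - hessian G f x ** C k x))"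
  unfolding laplacian_def[abs_def] C_def
  using smooth_metric_onD[OF G] entries_differentiable_hessian[OF G f x] x
  by (intro partial_deriv_metric_trace) auto

text \<open>The algebra of contracting the third-order equation: the three metric terms contribute
  \<open>2 n\<close>, \<open>1\<close> and \<open>1\<close> times the gradient. Here \<open>T\<close> has the
  entries \<open>\<nabla>\<^sub>k \<nabla>\<^sub>i \<nabla>\<^sub>j \<lambda>\<close> with \<open>k\<close> fixed, and \<open>d\<close> is the gradient.\<close>

lemma trace_contracted_equation:
  fixes G :: "real^'n^'n::finite"
  assumes sym: "transpose G = G" and inv: "invertible G"
    and T: "\<And>i j. T $ i $ j + 2 * d $ k * G $ i $ j + d $ i * G $ j $ k + d $ j * G $ i $ k = 0"
  shows "trace (matrix_inv G ** T) = - 2 * (real CARD('n) + 1) * d $ k"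
proof -
  let ?B = "matrix_inv G"
  have Gs: "G $ i $ j = G $ j $ i" for i j
    using arg_cong[OF sym, of "\<lambda>M. M $ j $ i"] by (simp add: transpose_def)
  have GB: "(\<Sum>i\<in>UNIV. G $ a $ i * ?B $ i $ b) = (if a = b then 1 else 0)"
    and BG: "(\<Sum>i\<in>UNIV. ?B $ a $ i * G $ i $ b) = (if a = b then 1 else 0)" for a b
    using invertible_matrix_inv[OF inv] by (simp_all add: vec_eq_iff matrix_matrix_mult_def mat_def)
  have "T $ j $ i = - (2 * d $ k * G $ j $ i + d $ i * G $ j $ k + d $ j * G $ k $ i)" for i j
    using T[of j i] by (simp add: Gs[of i k])
  then have "trace (?B ** T) = - ((\<Sum>i\<in>UNIV. \<Sum>j\<in>UNIV. ?B $ i $ j * (2 * d $ k * G $ j $ i))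
      + (\<Sum>i\<in>UNIV. \<Sum>j\<in>UNIV. ?B $ i $ j * (d $ i * G $ j $ k))
      + (\<Sum>i\<in>UNIV. \<Sum>j\<in>UNIV. ?B $ i $ j * (d $ j * G $ k $ i)))"
    unfolding trace_def matrix_matrix_mult_def
    by (simp only: vec_lambda_beta mult_minus_right distrib_left sum_negf sum.distrib)
  also have "(\<Sum>i\<in>UNIV. \<Sum>j\<in>UNIV. ?B $ i $ j * (2 * d $ k * G $ j $ i))
      = (\<Sum>i\<in>UNIV. 2 * d $ k * (\<Sum>j\<in>UNIV. ?B $ i $ j * G $ j $ i))"
    by (simp add: sum_distrib_left ac_simps)
  also have "\<dots> = 2 * real CARD('n) * d $ k" by (simp add: BG)
  also have "(\<Sum>i\<in>UNIV. \<Sum>j\<in>UNIV. ?B $ i $ j * (d $ i * G $ j $ k))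
      = (\<Sum>i\<in>UNIV. d $ i * (\<Sum>j\<in>UNIV. ?B $ i $ j * G $ j $ k))"
    by (simp add: sum_distrib_left ac_simps)
  also have "\<dots> = d $ k" by (simp add: BG if_distrib cong: if_cong)
  also have "(\<Sum>i\<in>UNIV. \<Sum>j\<in>UNIV. ?B $ i $ j * (d $ j * G $ k $ i))
      = (\<Sum>j\<in>UNIV. d $ j * (\<Sum>i\<in>UNIV. G $ k $ i * ?B $ i $ j))"
    by (subst sum.swap) (simp add: sum_distrib_left ac_simps)
  also have "\<dots> = d $ k" by (simp add: GB if_distrib cong: if_cong)
  finally show ?thesis by (simp add: algebra_simps)
qed

section \<open>Coordinate independence of the Laplacian\<close>

definition jacobian :: "(real^'n::finite \<Rightarrow> real^'n) \<Rightarrow> real^'n \<Rightarrow> real^'n^'n" where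
  "jacobian \<tau> x = (\<chi> a i. partial_deriv i (\<lambda>y. \<tau> y $ a) x)"

text \<open>The transformation law of the Christoffel symbols. It is obtained from uniqueness: the law dictates
  matrices \<open>D k\<close>, and these are symmetric in the lower indices (as second derivatives of \<open>\<tau>\<close>
  commute) and make the pulled-back metric parallel (by the product rule).\<close>

lemma christoffel_matrix_transform:
  fixes \<tau> :: "real^'n::finite \<Rightarrow> real^'n"
  assumes \<tau>: "smooth_on \<tau> U" "\<tau> ` U \<subseteq> V" and G: "smooth_metric_on G U" "smooth_metric_on G' V"
    and pull: "\<And>y. y \<in> U \<Longrightarrow> G y = transpose (jacobian \<tau> y) ** G' (\<tau> y) ** jacobian \<tau> y"
    and x: "x \<in> U"
  shows "jacobian \<tau> x ** christoffel_matrix G k x = matrix_partial k (jacobian \<tau>) x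
     + (\<Sum>p\<in>UNIV. jacobian \<tau> x $ p $ k *\<^sub>R christoffel_matrix G' p (\<tau> x)) ** jacobian \<tau> x"
proof -
  let ?J = "jacobian \<tau>" and ?K = "\<lambda>k. matrix_partial k (jacobian \<tau>) x" and ?G = "G' (\<tau> x)"
  \<comment> \<open>\<open>E k\<close> is the connection of \<open>G'\<close> in the direction of the \<open>k\<close>-th column of the Jacobian.\<close>
  define E where "E k = (\<Sum>p\<in>UNIV. ?J x $ p $ k *\<^sub>R christoffel_matrix G' p (\<tau> x))" for k
  define D where "D k = matrix_inv (?J x) ** (?K k + E k ** ?J x)" for k
  note G1 = smooth_metric_onD[OF G(1)] and G2 = smooth_metric_onD[OF G(2)]
  have y: "\<tau> x \<in> V" using \<tau> x by auto
  have \<tau>a: "smooth_on (\<lambda>y. \<tau> y $ a) U" for a by (rule smooth_on_component[OF G1(1) \<tau>(1)])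
  have \<tau>d: "\<tau> differentiable at x" by (rule smooth_on_imp_differentiable[OF \<tau>(1) x])
  have Jd: "entries_differentiable ?J x"
    unfolding entries_differentiable_def jacobian_def
    using smooth_on_imp_differentiable[OF smooth_on_partial_deriv[OF \<tau>a] x] by simp
  have Gd: "(\<lambda>y. G' y $ i $ j) differentiable at (\<tau> x)" for i j
    using G2(5)[OF y] by (simp add: entries_differentiable_def)
  have G\<tau>d: "entries_differentiable (\<lambda>y. G' (\<tau> y)) x"
    unfolding entries_differentiable_def
    using differentiable_chain_at[OF \<tau>d Gd] by (simp add: o_def)
  have Jinv: "invertible (?J x)"
    using G1(3)[OF x] pull[OF x] invertible_congruenceD by metis
  note JJ = invertible_matrix_inv[OF Jinv]
  have JD: "?J x ** D k = ?K k + E k ** ?J x" for k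
    by (simp add: D_def JJ matrix_mul_assoc)
  have par: "matrix_partial p G' (\<tau> x) = transpose (christoffel_matrix G' p (\<tau> x)) ** ?G
      + ?G ** christoffel_matrix G' p (\<tau> x)" for p
    using christoffel_parallel(2)[of V "\<tau> x" G'] G2 y by blast
  have dG\<tau>: "matrix_partial k (\<lambda>y. G' (\<tau> y)) x = transpose (E k) ** ?G + ?G ** E k" for k
  proof -
    have A: "(transpose (E k) ** ?G) $ i $ j
        = (\<Sum>p\<in>UNIV. \<Sum>q\<in>UNIV. ?J x $ p $ k * christoffel_matrix G' p (\<tau> x) $ q $ i * ?G $ q $ j)" for i j
      by (simp add: E_def matrix_matrix_mult_def transpose_def sum_distrib_right) (rule sum.swap)
    have "(?G ** E k) $ i $ j
        = (\<Sum>q\<in>UNIV. \<Sum>p\<in>UNIV. ?J x $ p $ k * ?G $ i $ q * christoffel_matrix G' p (\<tau> x) $ q $ j)" for i j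
      by (simp add: E_def matrix_matrix_mult_def sum_distrib_left ac_simps)
    then have B: "(?G ** E k) $ i $ j
        = (\<Sum>p\<in>UNIV. \<Sum>q\<in>UNIV. ?J x $ p $ k * ?G $ i $ q * christoffel_matrix G' p (\<tau> x) $ q $ j)" for i j
      by (subst sum.swap)
    have "matrix_partial k (\<lambda>y. G' (\<tau> y)) x $ i $ j
        = (transpose (E k) ** ?G + ?G ** E k) $ i $ j" for i j
    proof -
      have "matrix_partial k (\<lambda>y. G' (\<tau> y)) x $ i $ j
          = (\<Sum>p\<in>UNIV. ?J x $ p $ k * matrix_partial p G' (\<tau> x) $ i $ j)"
        using partial_deriv_compose[OF Gd \<tau>d] by (simp add: matrix_partial_def jacobian_def)
      also have "\<dots> = (\<Sum>p\<in>UNIV. \<Sum>q\<in>UNIV. ?J x $ p $ k * christoffel_matrix G' p (\<tau> x) $ q $ i * ?G $ q $ j)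
          + (\<Sum>p\<in>UNIV. \<Sum>q\<in>UNIV. ?J x $ p $ k * ?G $ i $ q * christoffel_matrix G' p (\<tau> x) $ q $ j)"
        by (simp add: par matrix_matrix_mult_def transpose_def sum.distrib sum_distrib_left
            distrib_left mult.assoc)
      also have "\<dots> = (transpose (E k) ** ?G + ?G ** E k) $ i $ j"
        by (simp add: A B)
      finally show ?thesis .
    qed
    then show ?thesis by (simp add: vec_eq_iff)
  qed
  have "D k = christoffel_matrix G k x"
  proof (rule christoffel_matrix_unique[of U x G])
    show "D i $ a $ j = D j $ a $ i" for a i j
    proof -
      have "?K i $ b $ j = ?K j $ b $ i" for b
        using partial_deriv_commute[OF \<tau>a G1(1) x] by (simp add: matrix_partial_def jacobian_def)
      moreover have "(E i ** ?J x) $ b $ j = (E j ** ?J x) $ b $ i" for b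
      proof -
        have sym: "christoffel_matrix G' p (\<tau> x) $ b $ q = christoffel_matrix G' q (\<tau> x) $ b $ p" for p q
          unfolding christoffel_matrix_def
          using christoffel_parallel(1)[of V "\<tau> x" G'] G2 y by simp
        have *: "(E i ** ?J x) $ b $ j = (\<Sum>q\<in>UNIV. \<Sum>p\<in>UNIV. ?J x $ p $ i * christoffel_matrix G' p (\<tau> x) $ b $ q * ?J x $ q $ j)" for i j
          by (simp add: E_def matrix_matrix_mult_def sum_distrib_right)
        show ?thesis
          unfolding * by (subst sum.swap) (intro sum.cong refl, simp add: sym)
      qed
      ultimately have "(?K i + E i ** ?J x) $ b $ j = (?K j + E j ** ?J x) $ b $ i" for b
        by simp
      then show ?thesis
        unfolding D_def matrix_matrix_mult_def[of "matrix_inv (?J x)"] by simp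
    qed
    show "matrix_partial k G x = transpose (D k) ** G x + G x ** D k" for k
    proof -
      have "matrix_partial k G x = matrix_partial k (\<lambda>y. transpose (?J y) ** G' (\<tau> y) ** ?J y) x"
        by (rule matrix_partial_cong_open[OF G1(1) x pull])
      also have "\<dots> = transpose (?K k + E k ** ?J x) ** ?G ** ?J x
          + transpose (?J x) ** ?G ** (?K k + E k ** ?J x)"
        by (simp add: matrix_partial_mult entries_differentiable_mult entries_differentiable_transpose
            matrix_partial_transpose Jd G\<tau>d dG\<tau> matrix_transpose_mul transpose_add
            matrix_add_ldistrib matrix_mult_add_left matrix_mul_assoc)
      also have "\<dots> = transpose (D k) ** G x + G x ** D k"
        unfolding JD[symmetric] pull[OF x] by (simp add: matrix_transpose_mul matrix_mul_assoc)
      finally show ?thesis .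
    qed
  qed (use G1 x in auto)
  then show ?thesis using JD[of k] by (simp add: E_def)
qed

text \<open>The Hessian is a tensor: the inhomogeneous second-derivative terms of \<open>\<tau>\<close>, one from the chain rule
  and one from the Christoffel symbols, cancel.\<close>

lemma hessian_transform:
  fixes \<tau> :: "real^'n::finite \<Rightarrow> real^'n"
  assumes \<tau>: "smooth_on \<tau> U" "\<tau> ` U \<subseteq> V" and G: "smooth_metric_on G U" "smooth_metric_on G' V"
    and pull: "\<And>y. y \<in> U \<Longrightarrow> G y = transpose (jacobian \<tau> y) ** G' (\<tau> y) ** jacobian \<tau> y"
    and f: "smooth_on f' V" "\<And>y. y \<in> U \<Longrightarrow> f y = f' (\<tau> y)"
    and x: "x \<in> U"
  shows "hessian G f x = transpose (jacobian \<tau> x) ** hessian G' f' (\<tau> x) ** jacobian \<tau> x"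
proof -
  let ?J = "jacobian \<tau>" and ?d = "\<lambda>b. partial_deriv b f' (\<tau> x)"
  note U = smooth_metric_onD(1)[OF G(1)]
  have y: "\<tau> x \<in> V" using \<tau> x by auto
  have \<tau>d: "\<tau> differentiable at y" if "y \<in> U" for y
    by (rule smooth_on_imp_differentiable[OF \<tau>(1) that])
  have Jd: "(\<lambda>y. ?J y $ a $ i) differentiable at x" for a i
    unfolding jacobian_def
    using smooth_on_imp_differentiable[OF smooth_on_partial_deriv[OF smooth_on_component[OF U \<tau>(1)]] x]
    by simp
  have f'd: "partial_deriv b f' differentiable at (\<tau> x)" for b
    by (rule smooth_on_imp_differentiable[OF smooth_on_partial_deriv[OF f(1)] y])
  have f'\<tau>d: "(\<lambda>y. partial_deriv b f' (\<tau> y)) differentiable at x" for b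
    using differentiable_chain_at[OF \<tau>d[OF x] f'd] by (simp add: o_def)
  have 1: "partial_deriv j f y = (\<Sum>b\<in>UNIV. ?J y $ b $ j * partial_deriv b f' (\<tau> y))"
    if "y \<in> U" for y j
  proof -
    have "partial_deriv j f y = partial_deriv j (\<lambda>y. f' (\<tau> y)) y"
      by (rule partial_deriv_cong_open[OF U that f(2)])
    also have "\<dots> = (\<Sum>b\<in>UNIV. ?J y $ b $ j * partial_deriv b f' (\<tau> y))"
      using smooth_on_imp_differentiable[OF f(1)] \<tau>(2) that
      by (subst partial_deriv_compose[OF _ \<tau>d[OF that]]) (auto simp: jacobian_def)
    finally show ?thesis .
  qed
  have 2: "partial_deriv i (partial_deriv j f) x = (\<Sum>b\<in>UNIV. matrix_partial i ?J x $ b $ j * ?d b)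
      + (\<Sum>b\<in>UNIV. \<Sum>a\<in>UNIV. ?J x $ b $ j * ?J x $ a $ i * partial_deriv a (partial_deriv b f') (\<tau> x))" for i j
  proof -
    have "partial_deriv i (partial_deriv j f) x
        = partial_deriv i (\<lambda>y. \<Sum>b\<in>UNIV. ?J y $ b $ j * partial_deriv b f' (\<tau> y)) x"
      by (rule partial_deriv_cong_open[OF U x 1])
    also have "\<dots> = (\<Sum>b\<in>UNIV. ?J x $ b $ j * partial_deriv i (\<lambda>y. partial_deriv b f' (\<tau> y)) x
        + matrix_partial i ?J x $ b $ j * ?d b)"
      by (simp add: partial_deriv_sum partial_deriv_mult differentiable_mult Jd f'\<tau>d matrix_partial_def)
    finally show ?thesis
      by (simp add: partial_deriv_compose[OF f'd \<tau>d[OF x]] jacobian_def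
          sum.distrib sum_distrib_left mult.assoc)
  qed
  have 3: "(\<Sum>m\<in>UNIV. christoffel G m i j x * partial_deriv m f x)
      = (\<Sum>b\<in>UNIV. matrix_partial i ?J x $ b $ j * ?d b)
      + (\<Sum>q\<in>UNIV. \<Sum>p\<in>UNIV. \<Sum>b\<in>UNIV. ?J x $ p $ i * ?J x $ q $ j * (christoffel G' b p q (\<tau> x) * ?d b))" for i j
  proof -
    have transform: "?J x ** christoffel_matrix G i x = matrix_partial i ?J x
        + (\<Sum>p\<in>UNIV. ?J x $ p $ i *\<^sub>R christoffel_matrix G' p (\<tau> x)) ** ?J x"
      by (rule christoffel_matrix_transform[OF \<tau> G _ x]) (rule pull)
    have "(\<Sum>m\<in>UNIV. christoffel G m i j x * partial_deriv m f x)
        = (\<Sum>b\<in>UNIV. (?J x ** christoffel_matrix G i x) $ b $ j * ?d b)"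
      by (simp add: 1[OF x] christoffel_matrix_def matrix_matrix_mult_def sum_distrib_left sum_distrib_right
          ac_simps) (rule sum.swap)
    also have "\<dots> = (\<Sum>b\<in>UNIV. matrix_partial i ?J x $ b $ j * ?d b)
      + (\<Sum>b\<in>UNIV. \<Sum>q\<in>UNIV. \<Sum>p\<in>UNIV. ?J x $ p $ i * ?J x $ q $ j * (christoffel G' b p q (\<tau> x) * ?d b))"
      unfolding transform
      by (simp add: matrix_matrix_mult_def christoffel_matrix_def sum_distrib_left sum_distrib_right
          distrib_left distrib_right sum.distrib ac_simps)
    also have "(\<Sum>b\<in>UNIV. \<Sum>q\<in>UNIV. \<Sum>p\<in>UNIV. ?J x $ p $ i * ?J x $ q $ j * (christoffel G' b p q (\<tau> x) * ?d b))
      = (\<Sum>q\<in>UNIV. \<Sum>b\<in>UNIV. \<Sum>p\<in>UNIV. ?J x $ p $ i * ?J x $ q $ j * (christoffel G' b p q (\<tau> x) * ?d b))"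
      by (rule sum.swap)
    also have "\<dots> = (\<Sum>q\<in>UNIV. \<Sum>p\<in>UNIV. \<Sum>b\<in>UNIV. ?J x $ p $ i * ?J x $ q $ j * (christoffel G' b p q (\<tau> x) * ?d b))"
      by (intro sum.cong refl sum.swap)
    finally show ?thesis .
  qed
  have "hessian G f x $ i $ j = (transpose (?J x) ** hessian G' f' (\<tau> x) ** ?J x) $ i $ j" for i j
  proof -
    have "hessian G f x $ i $ j = (\<Sum>q\<in>UNIV. \<Sum>p\<in>UNIV. ?J x $ q $ j * ?J x $ p $ i * partial_deriv p (partial_deriv q f') (\<tau> x))
       - (\<Sum>q\<in>UNIV. \<Sum>p\<in>UNIV. \<Sum>b\<in>UNIV. ?J x $ p $ i * ?J x $ q $ j * (christoffel G' b p q (\<tau> x) * ?d b))"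
      by (simp add: hessian_def 2 3)
    also have "\<dots> = (\<Sum>q\<in>UNIV. \<Sum>p\<in>UNIV. ?J x $ p $ i * ?J x $ q $ j * hessian G' f' (\<tau> x) $ p $ q)"
      unfolding sum_subtractf[symmetric]
      by (intro sum.cong refl) (simp add: hessian_def right_diff_distrib sum_distrib_left)
    also have "\<dots> = (transpose (?J x) ** hessian G' f' (\<tau> x) ** ?J x) $ i $ j"
      by (simp add: matrix_matrix_mult_def transpose_def sum_distrib_left sum_distrib_right ac_simps)
    finally show ?thesis .
  qed
  then show ?thesis by (simp add: vec_eq_iff)
qed

lemma laplacian_transform:
  fixes \<tau> :: "real^'n::finite \<Rightarrow> real^'n"
  assumes \<tau>: "smooth_on \<tau> U" "\<tau> ` U \<subseteq> V" and G: "smooth_metric_on G U" "smooth_metric_on G' V"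
    and pull: "\<And>y. y \<in> U \<Longrightarrow> G y = transpose (jacobian \<tau> y) ** G' (\<tau> y) ** jacobian \<tau> y"
    and f: "smooth_on f' V" "\<And>y. y \<in> U \<Longrightarrow> f y = f' (\<tau> y)"
    and x: "x \<in> U"
  shows "laplacian G f x = laplacian G' f' (\<tau> x)"
proof -
  have "hessian G f x = transpose (jacobian \<tau> x) ** hessian G' f' (\<tau> x) ** jacobian \<tau> x"
    by (rule hessian_transform[OF \<tau> G _ f(1) _ x]) (simp_all add: pull f(2))
  then show ?thesis
    using trace_matrix_inv_congruence smooth_metric_onD(3)[OF G(1) x]
    by (simp add: laplacian_def pull[OF x])
qed

section \<open>Sign of the Laplacian at an extremum\<close>

text \<open>At a maximum the gradient vanishes, so the Hessian is the matrix of second partial derivatives, which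
  is negative semidefinite; so is the inverse of a negative definite metric. The pairing of two
  negative semidefinite forms is nonnegative.\<close>

lemma laplacian_nonneg_at_max:
  fixes G :: "real^'n::finite \<Rightarrow> real^'n^'n"
  assumes f: "smooth_on f S" and S: "open S" "x \<in> S" and max: "\<And>y. y \<in> S \<Longrightarrow> f y \<le> f x"
    and sym: "transpose (G x) = G x" and neg: "\<And>v. v \<noteq> 0 \<Longrightarrow> v \<bullet> (G x *v v) < 0"
  shows "0 \<le> laplacian G f x"
proof -
  let ?B = "matrix_inv (G x)"
  define N where "N = (\<chi> i j. - partial_deriv j (partial_deriv i f) x)"
  note test = second_derivative_nonpos_at_max[OF f S max]
  have inv: "invertible (G x)" using neg by (intro definite_imp_invertible) (metis less_irrefl)
  have "0 \<le> (\<Sum>i\<in>UNIV. \<Sum>j\<in>UNIV. (- ?B) $ i $ j * N $ i $ j)"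
  proof (rule psd_pairing_nonneg)
    show "transpose (- ?B) = - ?B"
      using transpose_matrix_inv[OF inv] sym by (simp add: vec_eq_iff transpose_def)
    show "0 \<le> v \<bullet> (- ?B *v v)" for v
      using matrix_inv_negative_definite[OF neg, of v]
      by (simp add: inner_matrix_vector sum_negf)
    show "0 \<le> v \<bullet> (N *v v)" for v
      using test(2)[of v] by (simp add: inner_matrix_vector N_def sum_negf)
  qed
  also have "\<dots> = laplacian G f x"
    by (simp add: laplacian_def hessian_def trace_def matrix_matrix_mult_def N_def test(1))
  finally show ?thesis .
qed

lemma laplacian_uminus:
  assumes f: "smooth_on f S" and S: "open S" "x \<in> S"
  shows "laplacian G (\<lambda>y. - f y) x = - laplacian G f x"
proof -
  have 1: "partial_deriv j (\<lambda>y. - f y) y = - partial_deriv j f y" if "y \<in> S" for j y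
    by (rule partial_deriv_uminus[OF smooth_on_imp_differentiable[OF f that]])
  have 2: "partial_deriv i (partial_deriv j (\<lambda>y. - f y)) x = - partial_deriv i (partial_deriv j f) x" for i j
  proof -
    have "partial_deriv i (partial_deriv j (\<lambda>y. - f y)) x = partial_deriv i (\<lambda>y. - partial_deriv j f y) x"
      by (rule partial_deriv_cong_open[OF S 1])
    also have "\<dots> = - partial_deriv i (partial_deriv j f) x"
      by (rule partial_deriv_uminus[OF smooth_on_imp_differentiable[OF smooth_on_partial_deriv[OF f] S(2)]])
    finally show ?thesis .
  qed
  have "hessian G (\<lambda>y. - f y) x $ i $ j = - hessian G f x $ i $ j" for i j
    by (simp add: hessian_def 1[OF S(2)] 2 sum_negf)
  then show ?thesis
    by (simp add: laplacian_def trace_def matrix_matrix_mult_def sum_negf)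
qed

section \<open>Iterated covariant derivatives\<close>

lemma nabla_eq_hessian:
  "nabla g c f [i, j] x = hessian (g c) (f \<circ> chart_inv c) x $ i $ j"
proof -
  have "nabla g c f [j] = partial_deriv j (f \<circ> chart_inv c)" for j
    by (rule ext) (rule nabla_simps(1))
  then show ?thesis by (simp only: nabla_simps(2) hessian_def vec_lambda_beta)
qed

lemma nabla_third:
  defines "H \<equiv> \<lambda>g c f. hessian (g c) (f \<circ> chart_inv c)" and "C \<equiv> \<lambda>g c. christoffel_matrix (g c)"
  shows "nabla g c f [k, i, j] x = (matrix_partial k (H g c f) x
    - transpose (C g c k x) ** H g c f x - H g c f x ** C g c k x) $ i $ j"
proof -
  have "nabla g c f [i, j] = (\<lambda>x. H g c f x $ i $ j)" for i j
    unfolding H_def by (rule ext) (rule nabla_eq_hessian)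
  then show ?thesis
    by (simp add: nabla_simps(3) matrix_partial_def matrix_matrix_mult_def transpose_def C_def
        christoffel_matrix_def mult.commute)
qed

text \<open>Contract the third-order equation in its last two derivatives; the contraction passes through
  \<open>\<nabla>\<^sub>k\<close> by \<open>partial_deriv_laplacian\<close>.\<close>

lemma gradient_laplacian_equation:
  fixes g :: "('m, 'n::finite) tensor2"
  assumes G: "smooth_metric_on (g c) S" and f: "smooth_on (f \<circ> chart_inv c) S" and x: "x \<in> S"
    and eq: "\<And>i j k. nabla g c f [k, j, i] x + 2 * nabla g c f [k] x * g c x $ i $ j
        + nabla g c f [i] x * g c x $ j $ k + nabla g c f [j] x * g c x $ i $ k = 0"
  shows "partial_deriv k (\<lambda>x. laplacian (g c) (f \<circ> chart_inv c) x
           + 2 * (real CARD('n) + 1) * (f \<circ> chart_inv c) x) x = 0"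
proof -
  let ?f = "f \<circ> chart_inv c" and ?H = "hessian (g c) (f \<circ> chart_inv c)" and ?C = "christoffel_matrix (g c) k x"
  define T where "T = matrix_partial k ?H x - transpose ?C ** ?H x - ?H x ** ?C"
  define d where "d = (\<chi> i. partial_deriv i ?f x)"
  have sym: "g c x $ i $ j = g c x $ j $ i" for i j
    using arg_cong[OF smooth_metric_onD(2)[OF G x], of "\<lambda>M. M $ j $ i"] by (simp add: transpose_def)
  have "T $ i $ j + 2 * d $ k * g c x $ i $ j + d $ i * g c x $ j $ k + d $ j * g c x $ i $ k = 0" for i j
    using eq[of k i j] by (simp add: nabla_third T_def d_def nabla_simps(1) sym[of j i])
  then have "trace (matrix_inv (g c x) ** T) = - 2 * (real CARD('n) + 1) * d $ k"
    using smooth_metric_onD(2,3)[OF G x] by (intro trace_contracted_equation)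
  then have lap: "partial_deriv k (laplacian (g c) ?f) x = - 2 * (real CARD('n) + 1) * partial_deriv k ?f x"
    unfolding partial_deriv_laplacian[OF G f x] T_def d_def by simp
  have fd: "?f differentiable at x" by (rule smooth_on_imp_differentiable[OF f x])
  have "partial_deriv k (\<lambda>x. 2 * (real CARD('n) + 1) * ?f x) x
      = 2 * (real CARD('n) + 1) * partial_deriv k ?f x"
    by (subst partial_deriv_mult) (use fd in simp_all)
  moreover have "(\<lambda>x. 2 * (real CARD('n) + 1) * ?f x) differentiable at x"
    using fd by (intro differentiable_mult differentiable_const)
  ultimately have "partial_deriv k (\<lambda>x. laplacian (g c) ?f x + 2 * (real CARD('n) + 1) * ?f x) x
      = partial_deriv k (laplacian (g c) ?f) x + 2 * (real CARD('n) + 1) * partial_deriv k ?f x"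
    by (subst partial_deriv_add) (simp_all only: differentiable_laplacian[OF G f x])
  also have "\<dots> = 0" unfolding lap by (simp add: algebra_simps)
  finally show ?thesis .
qed

section \<open>Charts\<close>

lemma chart_onD:
  assumes "chart_on X c"
  shows "openin X (fst c)" "open (chart_image c)" "inj_on (snd c) (fst c)"
    "homeomorphic_map (subtopology X (fst c)) (top_of_set (chart_image c)) (snd c)"
proof -
  show 1: "openin X (fst c)" "open (chart_image c)"
    "homeomorphic_map (subtopology X (fst c)) (top_of_set (chart_image c)) (snd c)"
    using assms by (auto simp: chart_on_def)
  then show "inj_on (snd c) (fst c)"
    using homeomorphic_imp_injective_map[OF 1(3)] openin_subset[OF 1(1)]
    by (simp add: Int_absorb1)
qed

lemma chart_inv_left:
  "chart_on X c \<Longrightarrow> p \<in> fst c \<Longrightarrow> chart_inv c (snd c p) = p"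
  unfolding chart_inv_def by (intro inv_into_f_f chart_onD(3))

lemma open_chart_image_of_open:
  assumes c: "chart_on X c" and U: "openin X U"
  shows "open (snd c ` (fst c \<inter> U))"
proof -
  have "openin (subtopology X (fst c)) (fst c \<inter> U)"
    using U by (auto simp: openin_subtopology)
  then have "openin (top_of_set (chart_image c)) (snd c ` (fst c \<inter> U))"
    using homeomorphic_imp_open_map[OF chart_onD(4)[OF c]] by (simp add: open_map_def)
  then show ?thesis using chart_onD(2)[OF c] openin_open_trans by blast
qed

lemma openin_chart_preimage:
  assumes c: "chart_on X c" and W: "open W"
  shows "openin X {p \<in> fst c. snd c p \<in> W}"
proof -
  have "continuous_map (subtopology X (fst c)) (top_of_set (chart_image c)) (snd c)"
    using homeomorphic_imp_continuous_map[OF chart_onD(4)[OF c]] .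
  then have "continuous_map (subtopology X (fst c)) euclidean (snd c)"
    using continuous_map_into_fulltopology by blast
  then have "openin (subtopology X (fst c)) {p \<in> topspace (subtopology X (fst c)). snd c p \<in> W}"
    using iffD1[OF open_openin W] by (rule openin_continuous_map_preimage)
  moreover have "topspace (subtopology X (fst c)) = fst c"
    using openin_subset[OF chart_onD(1)[OF c]] by (simp add: Int_absorb1)
  ultimately show ?thesis using chart_onD(1)[OF c] by (metis openin_trans_full)
qed

lemma smooth_manifold_chart_at:
  assumes "smooth_manifold X A" "p \<in> topspace X"
  obtains c where "c \<in> A" "p \<in> fst c"
proof -
  have "p \<in> (\<Union>c\<in>A. fst c)" using assms by (simp add: smooth_manifold_def)
  then show thesis using that by blast
qed

lemma smooth_function_continuous:
  assumes M: "smooth_manifold X A" and f: "smooth_function A f"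
  shows "continuous_map X euclideanreal f"
proof (rule pasting_lemma[of A X fst])
  fix c assume c: "c \<in> A"
  then have ch: "chart_on X c" using M by (simp add: smooth_manifold_def)
  then show "openin X (fst c)" by (rule chart_onD)
  have "continuous_map (top_of_set (chart_image c)) euclideanreal (f \<circ> chart_inv c)"
    using smooth_on_imp_continuous_on[of "f \<circ> chart_inv c"] f c
    by (simp add: smooth_function_def del: o_apply)
  then have "continuous_map (subtopology X (fst c)) euclideanreal ((f \<circ> chart_inv c) \<circ> snd c)"
    using homeomorphic_imp_continuous_map[OF chart_onD(4)[OF ch]] continuous_map_compose by blast
  then show "continuous_map (subtopology X (fst c)) euclideanreal f"
    by (rule continuous_map_eq) (simp add: chart_inv_left[OF ch])
next
  show "\<exists>c. c \<in> A \<and> p \<in> fst c \<and> f p = f p" if "p \<in> topspace X" for p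
    using smooth_manifold_chart_at[OF M that] by blast
qed simp

lemma continuous_map_attains_max:
  fixes f :: "'m \<Rightarrow> real"
  assumes "compact_space X" "continuous_map X euclideanreal f" "topspace X \<noteq> {}"
  obtains p where "p \<in> topspace X" "\<And>q. q \<in> topspace X \<Longrightarrow> f q \<le> f p"
proof -
  have "compactin euclideanreal (f ` topspace X)"
    using image_compactin[OF _ assms(2)] assms(1) by (simp add: compact_space_def)
  then have "compact (f ` topspace X)" by simp
  then show thesis
    using compact_attains_sup[of "f ` topspace X"] assms(3) that by auto
qed

text \<open>The set where \<open>f\<close> takes a given value and its complement are both open.\<close>

lemma locally_constant_on_connected_space:
  assumes X: "connected_space X"
    and loc: "\<And>p. p \<in> topspace X \<Longrightarrow> \<exists>U. openin X U \<and> p \<in> U \<and> (\<forall>q\<in>U. f q = f p)"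
  shows "f constant_on topspace X"
proof (cases "topspace X = {}")
  case True
  then show ?thesis by (simp add: constant_on_def)
next
  case False
  then obtain p where p: "p \<in> topspace X" by blast
  have "openin X {q \<in> topspace X. Q (f q)}" for Q
  proof (subst openin_subopen, clarify)
    fix q assume q: "q \<in> topspace X" "Q (f q)"
    obtain U where U: "openin X U" "q \<in> U" "\<And>r. r \<in> U \<Longrightarrow> f r = f q" using loc[OF q(1)] by blast
    have "U \<subseteq> {q \<in> topspace X. Q (f q)}"
      using q U(3) openin_subset[OF U(1)] by auto
    then show "\<exists>T. openin X T \<and> q \<in> T \<and> T \<subseteq> {q \<in> topspace X. Q (f q)}"
      using U(1,2) by blast
  qed
  from this[of "\<lambda>t. t = f p"] this[of "\<lambda>t. t \<noteq> f p"]
  have "openin X {q \<in> topspace X. f q = f p}" "closedin X {q \<in> topspace X. f q = f p}"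
    by (auto simp: closedin_def elim: back_subst[of "openin X"])
  then have "{q \<in> topspace X. f q = f p} = topspace X"
    using X p unfolding connected_space_clopen_in by blast
  then show ?thesis by (auto simp: constant_on_def)
qed

section \<open>Functions satisfying the third-order equation\<close>

text \<open>Negative definiteness is stated through the Riemannian metric \<open>-g\<close>; this transfers smoothness, sign and
  the transformation law to \<open>g\<close> itself, in matrix form.\<close>

lemma negative_definite_metricD:
  assumes M: "smooth_manifold X A" and g: "negative_definite_metric A g" and c: "c \<in> A"
  shows "smooth_metric_on (g c) (chart_image c)"
    and "x \<in> chart_image c \<Longrightarrow> v \<noteq> 0 \<Longrightarrow> v \<bullet> (g c x *v v) < 0"
    and "d \<in> A \<Longrightarrow> x \<in> snd c ` (fst c \<inter> fst d) \<Longrightarrow>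
      g c x = transpose (jacobian (transition c d) x) ** g d (transition c d x) ** jacobian (transition c d) x"
proof -
  note g = g[unfolded negative_definite_metric_def riemannian_metric_def smooth_tensor2_def]
  have op: "open (chart_image c)" using M c by (auto simp: smooth_manifold_def chart_on_def)
  have neg: "v \<bullet> (g c x *v v) < 0" if "x \<in> chart_image c" "v \<noteq> 0" for x v
  proof -
    have "v \<bullet> ((- g c x) *v v) = - (v \<bullet> (g c x *v v))"
      by (simp add: inner_matrix_vector sum_negf)
    moreover have "v \<bullet> ((- g c x) *v v) > 0" using g c that by blast
    ultimately show ?thesis by linarith
  qed
  then show "x \<in> chart_image c \<Longrightarrow> v \<noteq> 0 \<Longrightarrow> v \<bullet> (g c x *v v) < 0" .
  have "transpose (g c x) = g c x" if "x \<in> chart_image c" for x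
  proof -
    have "transpose (- g c x) = - g c x" using g c that by auto
    then show ?thesis by (simp add: vec_eq_iff transpose_def)
  qed
  moreover have "invertible (g c x)" if "x \<in> chart_image c" for x
    using neg[OF that] by (intro definite_imp_invertible) (metis less_irrefl)
  moreover have "smooth_on (\<lambda>x. g c x $ i $ j) (chart_image c)" for i j
  proof -
    have "smooth_on (\<lambda>x. (- g c x) $ i $ j) (chart_image c)" using g c by blast
    from smooth_on_uminus[OF op this] show ?thesis by simp
  qed
  ultimately show "smooth_metric_on (g c) (chart_image c)"
    using op by (simp add: smooth_metric_on_def)
  assume d: "d \<in> A" and x: "x \<in> snd c ` (fst c \<inter> fst d)"
  have "(- g c x) $ i $ j = (\<Sum>a\<in>UNIV. \<Sum>b\<in>UNIV. (- g d (transition c d x)) $ a $ b *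
      partial_deriv i (\<lambda>y. transition c d y $ a) x * partial_deriv j (\<lambda>y. transition c d y $ b) x)" for i j
    using g c d x by blast
  then have "g c x $ i $ j = (\<Sum>a\<in>UNIV. \<Sum>b\<in>UNIV. g d (transition c d x) $ a $ b *
      jacobian (transition c d) x $ a $ i * jacobian (transition c d) x $ b $ j)" for i j
    by (simp add: sum_negf jacobian_def)
  also have "\<dots> i j = (transpose (jacobian (transition c d) x) ** g d (transition c d x)
      ** jacobian (transition c d) x) $ i $ j" for i j
    by (subst sum.swap) (simp add: matrix_matrix_mult_def transpose_def sum_distrib_left sum_distrib_right ac_simps)
  finally show "g c x = transpose (jacobian (transition c d) x) ** g d (transition c d x) ** jacobian (transition c d) x"
    by (simp add: vec_eq_iff)
qed

lemma laplacian_chart_independent: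
  assumes M: "smooth_manifold X A" and g: "negative_definite_metric A g" and f: "smooth_function A f"
    and c: "c \<in> A" "d \<in> A" and p: "p \<in> fst c" "p \<in> fst d"
  shows "laplacian (g c) (f \<circ> chart_inv c) (snd c p) = laplacian (g d) (f \<circ> chart_inv d) (snd d p)"
proof -
  let ?U = "snd c ` (fst c \<inter> fst d)" and ?\<tau> = "transition c d"
  have ch: "chart_on X c" "chart_on X d" using M c by (auto simp: smooth_manifold_def)
  have \<tau>: "?\<tau> (snd c q) = snd d q" if "q \<in> fst c" for q
    using that by (simp add: transition_def chart_inv_left[OF ch(1)])
  have sub: "?U \<subseteq> chart_image c" by (auto simp: chart_image_def)
  have "smooth_metric_on (g c) ?U"
    using negative_definite_metricD(1)[OF M g c(1)] sub
    by (rule smooth_metric_on_subset) (rule open_chart_image_of_open[OF ch(1) chart_onD(1)[OF ch(2)]])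
  moreover have "smooth_on ?\<tau> ?U" using M c by (simp add: smooth_manifold_def)
  moreover have "?\<tau> ` ?U \<subseteq> chart_image d" by (auto simp: \<tau> chart_image_def)
  moreover have "smooth_on (f \<circ> chart_inv d) (chart_image d)" using f c by (simp add: smooth_function_def)
  moreover have "(f \<circ> chart_inv c) y = (f \<circ> chart_inv d) (?\<tau> y)" if "y \<in> ?U" for y
    using that by (auto simp: \<tau> chart_inv_left[OF ch(1)] chart_inv_left[OF ch(2)])
  ultimately have "laplacian (g c) (f \<circ> chart_inv c) (snd c p) = laplacian (g d) (f \<circ> chart_inv d) (?\<tau> (snd c p))"
    using negative_definite_metricD(1)[OF M g c(2)] negative_definite_metricD(3)[OF M g c] p
    by (intro laplacian_transform[of ?\<tau> ?U "chart_image d"]) auto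
  then show ?thesis by (simp add: \<tau> p)
qed

lemma manifold_laplacian_nonneg_at_max:
  assumes M: "smooth_manifold X A" and g: "negative_definite_metric A g"
    and f: "smooth_on (f \<circ> chart_inv c) (chart_image c)"
    and c: "c \<in> A" "p \<in> fst c" and max: "\<And>q. q \<in> topspace X \<Longrightarrow> f q \<le> f p"
  shows "0 \<le> laplacian (g c) (f \<circ> chart_inv c) (snd c p)"
proof (rule laplacian_nonneg_at_max[OF f])
  have ch: "chart_on X c" using M c by (simp add: smooth_manifold_def)
  then show "open (chart_image c)" by (rule chart_onD)
  show x: "snd c p \<in> chart_image c" using c by (simp add: chart_image_def)
  show "(f \<circ> chart_inv c) y \<le> (f \<circ> chart_inv c) (snd c p)" if "y \<in> chart_image c" for y
    using that max c openin_subset[OF chart_onD(1)[OF ch]]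
    by (auto simp: chart_image_def chart_inv_left[OF ch])
  show "transpose (g c (snd c p)) = g c (snd c p)"
    using smooth_metric_onD(2)[OF negative_definite_metricD(1)[OF M g c(1)] x] .
  show "v \<bullet> (g c (snd c p) *v v) < 0" if "v \<noteq> 0" for v
    using negative_definite_metricD(2)[OF M g c(1) x that] .
qed

theorem theorem2:
  fixes X :: "'m topology"
    and A :: "('m, 'n::finite) chart set"
    and g :: "('m, 'n) tensor2"
    and lam :: "'m \<Rightarrow> real"
  assumes "smooth_manifold X A" and "compact_space X" and "connected_space X"
    and "negative_definite_metric A g"
    and "smooth_function A lam"
    and "\<forall>c\<in>A. \<forall>x\<in>chart_image c. \<forall>i j k.
           nabla g c lam [k, j, i] x
             + 2 * nabla g c lam [k] x * g c x $ i $ j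
             + nabla g c lam [i] x * g c x $ j $ k
             + nabla g c lam [j] x * g c x $ i $ k = 0"
  shows "lam constant_on topspace X"
proof (cases "topspace X = {}")
  case True
  then show ?thesis by (simp add: constant_on_def)
next
  case False
  note M = assms(1) and g = assms(4) and lam = assms(5)
  define N where "N = 2 * (real CARD('n) + 1)"
  have N: "N > 0" by (simp add: N_def)
  define lap where "lap c p = laplacian (g c) (lam \<circ> chart_inv c) (snd c p)" for c p
  \<comment> \<open>\<open>\<Phi>\<close> is computed in an arbitrarily chosen chart at each point; by chart independence it agrees
    on each chart domain with the expression in that chart.\<close>
  define chart_at where "chart_at p = (SOME c. c \<in> A \<and> p \<in> fst c)" for p
  define \<Phi> where "\<Phi> p = lap (chart_at p) p + N * lam p" for p
  have chart_at: "chart_at p \<in> A" "p \<in> fst (chart_at p)" if "p \<in> topspace X" for p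
  proof -
    have "\<exists>c. c \<in> A \<and> p \<in> fst c" using smooth_manifold_chart_at[OF M that] by blast
    from someI_ex[OF this] show "chart_at p \<in> A" "p \<in> fst (chart_at p)"
      by (simp_all add: chart_at_def)
  qed
  have ch: "chart_on X c" if "c \<in> A" for c using that M by (simp add: smooth_manifold_def)
  have in_X: "p \<in> topspace X" if "c \<in> A" "p \<in> fst c" for c p
    using that openin_subset[OF chart_onD(1)[OF ch]] by blast
  have \<Phi>: "\<Phi> p = lap c p + N * lam p" if "c \<in> A" "p \<in> fst c" for c p
    unfolding \<Phi>_def lap_def
    using laplacian_chart_independent[OF M g lam chart_at(1)[OF in_X[OF that]] that(1)
        chart_at(2)[OF in_X[OF that]] that(2)] by simp
  have lam_smooth: "smooth_on (lam \<circ> chart_inv c) (chart_image c)" if "c \<in> A" for c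
    using lam that by (simp add: smooth_function_def)
  have "\<Phi> constant_on topspace X"
  proof (rule locally_constant_on_connected_space[OF assms(3)])
    fix p assume p: "p \<in> topspace X"
    let ?c = "chart_at p"
    note c = chart_at[OF p]
    let ?F = "\<lambda>x. laplacian (g ?c) (lam \<circ> chart_inv ?c) x + N * (lam \<circ> chart_inv ?c) x"
    have x: "snd ?c p \<in> chart_image ?c" using c by (simp add: chart_image_def)
    obtain r where r: "r > 0" "ball (snd ?c p) r \<subseteq> chart_image ?c"
      using chart_onD(2)[OF ch[OF c(1)]] x open_contains_ball by blast
    have F: "?F y = ?F (snd ?c p)" if "y \<in> ball (snd ?c p) r" for y
    proof (rule constant_near_zero_partials[OF _ _ that])
      fix y assume "y \<in> ball (snd ?c p) r"
      then have y: "y \<in> chart_image ?c" using r by blast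
      note G = negative_definite_metricD(1)[OF M g c(1)]
      show "?F differentiable at y"
        using differentiable_laplacian[OF G lam_smooth[OF c(1)] y]
          smooth_on_imp_differentiable[OF lam_smooth[OF c(1)] y]
        by (intro differentiable_add differentiable_mult differentiable_const)
      show "partial_deriv k ?F y = 0" for k
        unfolding N_def
        by (rule gradient_laplacian_equation[where g = g and c = ?c and f = lam,
              OF G lam_smooth[OF c(1)] y]) (use assms(6) c(1) y in blast)
    qed
    have "\<Phi> q = \<Phi> p" if "q \<in> fst ?c" "snd ?c q \<in> ball (snd ?c p) r" for q
      using F[OF that(2)]
      by (simp only: \<Phi>[OF c(1) that(1)] \<Phi>[OF c] lap_def o_apply
          chart_inv_left[OF ch[OF c(1)] that(1)] chart_inv_left[OF ch[OF c(1)] c(2)])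
    then have "\<forall>q\<in>{q \<in> fst ?c. snd ?c q \<in> ball (snd ?c p) r}. \<Phi> q = \<Phi> p"
      by simp
    moreover have "openin X {q \<in> fst ?c. snd ?c q \<in> ball (snd ?c p) r}"
      by (rule openin_chart_preimage[OF ch[OF c(1)] open_ball])
    moreover have "p \<in> {q \<in> fst ?c. snd ?c q \<in> ball (snd ?c p) r}" using c(2) r(1) by simp
    ultimately show "\<exists>U. openin X U \<and> p \<in> U \<and> (\<forall>q\<in>U. \<Phi> q = \<Phi> p)"
      by (intro exI conjI)
  qed
  then obtain C where C: "\<And>p. p \<in> topspace X \<Longrightarrow> \<Phi> p = C" by (auto simp: constant_on_def)
  have cont: "continuous_map X euclideanreal lam" by (rule smooth_function_continuous[OF M lam])
  obtain p where p: "p \<in> topspace X" "\<And>q. q \<in> topspace X \<Longrightarrow> lam q \<le> lam p"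
    using continuous_map_attains_max[OF assms(2) cont False] by blast
  obtain m where m: "m \<in> topspace X" "\<And>q. q \<in> topspace X \<Longrightarrow> - lam q \<le> - lam m"
    using continuous_map_attains_max[OF assms(2) continuous_map_minus[OF cont] False] by blast
  note cp = chart_at[OF p(1)] and cm = chart_at[OF m(1)]
  have "0 \<le> lap (chart_at p) p"
    unfolding lap_def by (rule manifold_laplacian_nonneg_at_max[OF M g lam_smooth[OF cp(1)] cp p(2)])
  then have "N * lam p \<le> C" using C[OF p(1)] by (simp add: \<Phi>_def)
  \<comment> \<open>The minimum of \<open>lam\<close> is the maximum of \<open>- lam\<close>, and the Laplacian is odd.\<close>
  moreover have "0 \<le> - lap (chart_at m) m"
  proof -
    let ?f = "lam \<circ> chart_inv (chart_at m)"
    have op: "open (chart_image (chart_at m))" by (rule chart_onD(2)[OF ch[OF cm(1)]])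
    have o: "(\<lambda>q. - lam q) \<circ> chart_inv (chart_at m) = (\<lambda>y. - ?f y)" by (simp add: o_def)
    have "0 \<le> laplacian (g (chart_at m)) ((\<lambda>q. - lam q) \<circ> chart_inv (chart_at m)) (snd (chart_at m) m)"
      by (rule manifold_laplacian_nonneg_at_max[where f = "\<lambda>q. - lam q", OF M g _ cm m(2)])
        (use smooth_on_uminus[OF op lam_smooth[OF cm(1)]] in \<open>simp add: o_def\<close>)
    also have "\<dots> = - lap (chart_at m) m"
      unfolding lap_def o
      by (rule laplacian_uminus[OF lam_smooth[OF cm(1)] op]) (use cm in \<open>simp add: chart_image_def\<close>)
    finally show ?thesis .
  qed
  then have "C \<le> N * lam m" using C[OF m(1)] by (simp add: \<Phi>_def)
  ultimately have "lam p \<le> lam m" using N by (smt (verit) mult_le_cancel_left_pos)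
  then have "lam q = lam p" if "q \<in> topspace X" for q
    using p(2)[OF that] m(2)[OF that] by simp
  then show ?thesis by (auto simp: constant_on_def)
qed

end
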